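(* For every $z\in\mathbb C$ there is a $w$-NAF $\eta$ with finite left-length (and arbitrary, possibly infinite, right-length) such that $z=\mathrm{value}(\eta)=\sum_{j}\eta_j\tau^j$.
   Context: Let $p,q\in\mathbb Z$ with $4q-p^2>0$ and let $\tau$ be a root of $X^2-pX+q$, with $|\tau|>1$; let $w\ge2$ be an integer. Voronoi cell $V=\{z\in\mathbb C:|z|\le|z-y|\ \forall y\in\mathbb Z[\tau]\}$. Label its vertices counter-clockwise $v_0,\dots,v_{m-1}$ starting with the vertex of real part $1/2$ and positive imaginary part, indices mod $m$, $v_{k+1/2}$ the midpoint of $v_kv_{k+1}$. The restricted Voronoi cell $\widetilde V$ consists of the interior of $V$, the segments from $v_{k+1/2}$ (excluded) to $v_{k+1}$ (excluded) for all $k$, the points $v_{k+1/2}$ for $0\le k\le\lfloor m/2\rfloor-1$ and $v_k$ for $1\le k\le\lfloor m/3\rfloor$. Digit set $\mathcal D$: $0$ together with, for each residue class of $\mathbb Z[\tau]$ modulo $\tau^w$ not divisible by $\tau$, its unique element in $\tau^w\widetilde V$. A $w$-NAF is $\eta=(\eta_j)_{j\in\mathbb Z}\in\mathcal D^{\mathbb Z}$ with at most one nonzero digit in every block of $w$ consecutive digits; with $J=\{j:\eta_j\ne0\}$ its left-length is $\sup(\{0\}\cup(J+1))$ and right-length $-\inf(\{0\}\cup J)$. *)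

theory Defs
  imports "HOL-Analysis.Analysis" "HOL-Computational_Algebra.Polynomial"
begin

definition zring :: "complex \<Rightarrow> complex set" where
  "zring \<tau> = range (\<lambda>f :: int poly. poly (map_poly of_int f) \<tau>)"

definition zring_dvd :: "complex \<Rightarrow> complex \<Rightarrow> complex \<Rightarrow> bool" where
  "zring_dvd \<tau> x y \<longleftrightarrow> (\<exists>e \<in> zring \<tau>. y = x * e)"

definition residue_class :: "complex \<Rightarrow> nat \<Rightarrow> complex \<Rightarrow> complex set" where
  "residue_class \<tau> w x = {y \<in> zring \<tau>. zring_dvd \<tau> (\<tau> ^ w) (y - x)}"

definition voronoi :: "complex \<Rightarrow> complex set" where
  "voronoi \<tau> = {z. \<forall>y \<in> zring \<tau>. cmod z \<le> cmod (z - y)}"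

definition vor_vertices :: "complex \<Rightarrow> complex set" where
  "vor_vertices \<tau> = {v. v extreme_point_of voronoi \<tau>}"

definition vor_count :: "complex \<Rightarrow> nat" where
  "vor_count \<tau> = card (vor_vertices \<tau>)"

definition vor_vertex0 :: "complex \<Rightarrow> complex" where
  "vor_vertex0 \<tau> = (THE v. v \<in> vor_vertices \<tau> \<and> Re v = 1 / 2 \<and> Im v > 0)"

text \<open>Since 0 is an interior point of the convex Voronoi cell, the counter-clockwise order of its
  vertices is the order of their angles around 0, measured from the starting vertex. The vertex
  with index \<open>k\<close> is the one preceded by exactly \<open>k\<close> others (indices modulo the number of vertices).\<close>

definition vor_angle :: "complex \<Rightarrow> complex \<Rightarrow> real" where
  "vor_angle \<tau> v = Arg2pi (v / vor_vertex0 \<tau>)"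

definition vor_vertex :: "complex \<Rightarrow> nat \<Rightarrow> complex" where
  "vor_vertex \<tau> k = (THE v. v \<in> vor_vertices \<tau> \<and>
     card {u \<in> vor_vertices \<tau>. vor_angle \<tau> u < vor_angle \<tau> v} = k mod vor_count \<tau>)"

definition vor_midpoint :: "complex \<Rightarrow> nat \<Rightarrow> complex" where
  "vor_midpoint \<tau> k = midpoint (vor_vertex \<tau> k) (vor_vertex \<tau> (k + 1))"

definition restricted_voronoi :: "complex \<Rightarrow> complex set" where
  "restricted_voronoi \<tau> =
     interior (voronoi \<tau>)
     \<union> (\<Union>k \<in> {0..<vor_count \<tau>}. open_segment (vor_midpoint \<tau> k) (vor_vertex \<tau> (k + 1)))
     \<union> vor_midpoint \<tau> ` {0..<vor_count \<tau> div 2}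
     \<union> vor_vertex \<tau> ` {1..vor_count \<tau> div 3}"

definition digit_set :: "complex \<Rightarrow> nat \<Rightarrow> complex set" where
  "digit_set \<tau> w = {0} \<union>
     {(THE d. d \<in> residue_class \<tau> w x \<and> d \<in> (\<lambda>z. \<tau> ^ w * z) ` restricted_voronoi \<tau>) | x.
        x \<in> zring \<tau> \<and> \<not> zring_dvd \<tau> \<tau> x}"

definition w_NAF :: "complex \<Rightarrow> nat \<Rightarrow> (int \<Rightarrow> complex) \<Rightarrow> bool" where
  "w_NAF \<tau> w \<eta> \<longleftrightarrow> (\<forall>j. \<eta> j \<in> digit_set \<tau> w) \<and>
     (\<forall>j. card {i \<in> {j..<j + int w}. \<eta> i \<noteq> 0} \<le> 1)"

definition left_length :: "(int \<Rightarrow> complex) \<Rightarrow> ereal" where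
  "left_length \<eta> = Sup ({0} \<union> {ereal (of_int (j + 1)) | j. \<eta> j \<noteq> 0})"

end

theory Submission
  imports Defs "HOL-Library.Diagonal_Subsequence"
begin

text \<open>The lattice \<open>zring \<tau>\<close> is rectangular or rhombic according to the parity of \<open>p\<close>, so the
  Voronoi cell is an explicit rectangle or hexagon inscribed in a circle around 0, and the restricted
  cell is a fundamental domain of the lattice. Hence every lattice element \<open>x\<close> is \<open>\<tau> * y\<close> or
  \<open>d + \<tau> ^ w * y\<close> with a digit \<open>d\<close>. With \<open>\<rho> = sqrt (1 + q) / 2\<close>, a bound for the circumradius, the
  second step gives \<open>cmod y \<le> cmod x / cmod \<tau> ^ w + \<rho>\<close>, which is smaller than \<open>cmod x\<close> unless \<open>x\<close> is
  itself a digit or \<open>q = w = 2\<close> and \<open>(cmod x)\<^sup>2 \<le> 3\<close>; these last few elements are expanded by hand.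
  So every lattice element has a finite expansion, and the same estimate bounds its length by
  \<open>n + M\<close> when \<open>cmod x = O(cmod \<tau> ^ n)\<close>. For complex \<open>z\<close>, take lattice points \<open>x n\<close> near
  \<open>\<tau> ^ n * z\<close>; the shifted expansions of \<open>x n\<close> have uniformly bounded left-length, and since the
  digit set is finite a diagonal subsequence converges digitwise to an expansion of \<open>z\<close>.\<close>

section \<open>Vertices of the Voronoi cell\<close>

text \<open>Both shapes belong to one family: \<open>cell h s\<close> is a rectangle for
  \<open>s = 0\<close> and, for \<open>s > 0\<close>, a hexagon with apexes at heights
  \<open>h\<close> and \<open>-h\<close> and roof slope \<open>s\<close>. The boundary rule matters
  twice: the tiling has to be exact for the \<open>THE\<close> in the digit set to denote anything,
  and for q = w = 2 with even p some of the shortest elements fall on the boundary of the scaled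
  cell, so the rule decides whether x or -x is a digit. That case is exceptional because
  \<open>cmod \<tau> ^ w = 2\<close> and \<open>\<rho>\<close> is half the square root of 3: the
  required decrease says exactly that the squared modulus exceeds 3. Finite expansions alone do not
  give the limit. The points \<open>x n\<close> grow, and after the shift by n their leading
  positions could drift to infinity; hence the need for a length bound of the form n + M with one M
  for all n.\<close>

definition cell :: "real \<Rightarrow> real \<Rightarrow> complex set" where
  "cell h s = {z. \<bar>Re z\<bar> \<le> 1 / 2 \<and> \<bar>Im z\<bar> + s * \<bar>Re z\<bar> \<le> h}"

text \<open>An interior point may be pushed outwards by a factor slightly above 1 without leaving
  the cell, so each constraint, having a positive bound, was strict before.\<close>

lemma interior_cell:
  assumes h: "0 < h"
  shows "interior (cell h s) = {z. \<bar>Re z\<bar> < 1 / 2 \<and> \<bar>Im z\<bar> + s * \<bar>Re z\<bar> < h}" (is "_ = ?U")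
proof
  have "open ?U"
    by (intro open_Collect_conj open_Collect_less continuous_intros)
  then show "?U \<subseteq> interior (cell h s)"
    by (intro interior_maximal) (auto simp: cell_def)
  show "interior (cell h s) \<subseteq> ?U"
  proof
    fix z assume "z \<in> interior (cell h s)"
    then obtain e where e: "0 < e" "ball z e \<subseteq> cell h s" by (meson mem_interior)
    \<comment> \<open>The factor keeps the displacement \<open>(t - 1) * cmod z\<close> below
      \<open>e\<close>; the added 1 covers \<open>z = 0\<close>.\<close>
    define t where "t = 1 + e / (2 * (cmod z + 1))"
    have t: "1 < t" unfolding t_def using e(1) by (simp add: add_nonneg_pos)
    have "dist z (of_real t * z) = cmod ((of_real t - 1) * z)"
      by (simp add: dist_norm norm_minus_commute algebra_simps)
    also have "\<dots> = (t - 1) * cmod z"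
      using t by (metis abs_of_pos diff_gt_0_iff_gt norm_mult norm_of_real of_real_1 of_real_diff)
    also have "\<dots> = e * (cmod z / (2 * (cmod z + 1)))" by (simp add: t_def)
    also have "\<dots> < e * 1"
    proof (rule mult_strict_left_mono)
      have "0 < cmod z + 1" by (simp add: add_nonneg_pos)
      then show "cmod z / (2 * (cmod z + 1)) < 1" by (simp add: divide_less_eq)
    qed (rule e)
    finally have "of_real t * z \<in> cell h s" using e(2) by auto
    then have le: "t * \<bar>Re z\<bar> \<le> 1 / 2" "t * (\<bar>Im z\<bar> + s * \<bar>Re z\<bar>) \<le> h"
      using t by (auto simp: cell_def abs_mult algebra_simps)
    have *: "y < c" if "t * y \<le> c" "0 < c" for y c :: real
    proof (cases "0 < y")
      case True
      then have "y < t * y" using t by simp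
      then show ?thesis using that by simp
    qed (use that in simp)
    show "z \<in> ?U" using *[OF le(1)] *[OF le(2)] h by simp
  qed
qed

text \<open>A point strictly inside a segment is closer to 0 than one of the ends, so a point at the
  maximal distance \<open>r\<close> is never inside a segment of the hull. This yields the vertices
  without a study of edges.\<close>

lemma extreme_points_convex_hull_on_sphere:
  fixes S :: "'a::euclidean_space set"
  assumes S: "S \<subseteq> sphere 0 r"
  shows "{v. v extreme_point_of (convex hull S)} = S"
proof
  show "{v. v extreme_point_of (convex hull S)} \<subseteq> S"
    using extreme_point_of_convex_hull by auto
  have hull: "convex hull S \<subseteq> cball 0 r"
    using S sphere_cball by (intro hull_minimal) auto
  show "S \<subseteq> {v. v extreme_point_of (convex hull S)}"
  proof
    fix v assume v: "v \<in> S"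
    have "v \<notin> open_segment a b" if "a \<in> convex hull S" "b \<in> convex hull S" for a b
    proof
      assume "v \<in> open_segment a b"
      then have "dist 0 v < dist 0 a \<or> dist 0 v < dist 0 b" by (rule dist_decreases_open_segment)
      then show False using that v hull S by fastforce
    qed
    then show "v \<in> {v. v extreme_point_of (convex hull S)}"
      using v by (simp add: extreme_point_of_def hull_inc)
  qed
qed

text \<open>Angles increasing strictly within one turn make the rank in the definition of
  \<open>vor_vertex\<close> equal to the index, which eliminates its \<open>THE\<close> and
  \<open>card\<close>.\<close>

lemma
  fixes \<theta> :: "nat \<Rightarrow> real" and \<tau> :: complex
  assumes m: "0 < m" and r: "0 < r"
    and V: "vor_vertices \<tau> = (\<lambda>k. of_real r * cis (\<theta> k)) ` {..<m}"
    and v0: "vor_vertex0 \<tau> = of_real r * cis (\<theta> 0)"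
    and mono: "strict_mono_on {..<m} \<theta>"
    and turn: "\<And>k. k < m \<Longrightarrow> \<theta> k < \<theta> 0 + 2 * pi"
  shows vor_count_polar: "vor_count \<tau> = m"
    and vor_vertex_polar: "vor_vertex \<tau> k = of_real r * cis (\<theta> (k mod m))"
proof -
  define v where "v = (\<lambda>k. of_real r * cis (\<theta> k))"
  have Vv: "vor_vertices \<tau> = v ` {..<m}" by (simp add: V v_def)
  have mono': "\<theta> i < \<theta> j \<longleftrightarrow> i < j" if "i < m" "j < m" for i j
    using strict_mono_onD[OF mono, of i j] strict_mono_onD[OF mono, of j i] that
    by (cases i j rule: linorder_cases) auto
  have angle: "vor_angle \<tau> (v k) = \<theta> k - \<theta> 0" if "k < m" for k
    unfolding vor_angle_def
  proof (rule Arg2pi_unique[of 1])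
    show "complex_of_real 1 * exp (\<i> * complex_of_real (\<theta> k - \<theta> 0)) = v k / vor_vertex0 \<tau>"
      unfolding cis_conv_exp[symmetric] using r by (simp add: v0 v_def cis_divide)
    show "0 \<le> \<theta> k - \<theta> 0" using mono'[of k 0] m that by (simp add: not_less)
  qed (use turn[OF that] in simp_all)
  have inj: "inj_on v {..<m}"
  proof (rule inj_onI)
    fix i j assume ij: "i \<in> {..<m}" "j \<in> {..<m}" "v i = v j"
    then have "\<theta> i = \<theta> j" using angle by (metis add_diff_cancel diff_add_cancel lessThan_iff)
    then show "i = j" using mono'[of i j] mono'[of j i] ij by auto
  qed
  show count: "vor_count \<tau> = m"
    using inj card_image[OF inj] by (simp add: vor_count_def V v_def)
  have rank: "card {u \<in> vor_vertices \<tau>. vor_angle \<tau> u < vor_angle \<tau> (v j)} = j" if "j < m" for j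
  proof -
    have "{u \<in> vor_vertices \<tau>. vor_angle \<tau> u < vor_angle \<tau> (v j)} = v ` {..<j}"
      using that angle mono' by (auto simp: Vv)
    then show ?thesis using that inj by (simp add: card_image inj_on_subset)
  qed
  have "vor_vertex \<tau> k = v (k mod m)"
    unfolding vor_vertex_def count
  proof (rule the_equality)
    show "v (k mod m) \<in> vor_vertices \<tau> \<and>
      card {u \<in> vor_vertices \<tau>. vor_angle \<tau> u < vor_angle \<tau> (v (k mod m))} = k mod m"
      using rank[of "k mod m"] m by (auto simp: Vv)
    fix u assume u: "u \<in> vor_vertices \<tau> \<and>
      card {u' \<in> vor_vertices \<tau>. vor_angle \<tau> u' < vor_angle \<tau> u} = k mod m"
    then obtain j where "j < m" "u = v j" by (auto simp: V v_def)
    then show "u = v (k mod m)" using u rank by metis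
  qed
  then show "vor_vertex \<tau> k = of_real r * cis (\<theta> (k mod m))" by (simp add: v_def)
qed

lemma open_segment_graph:
  fixes a c \<beta> \<gamma> :: real
  assumes "a < c"
  shows "open_segment (Complex a (\<beta> + \<gamma> * a)) (Complex c (\<beta> + \<gamma> * c)) =
    {z. a < Re z \<and> Re z < c \<and> Im z = \<beta> + \<gamma> * Re z}" (is "?S = ?T")
proof
  show "?S \<subseteq> ?T"
  proof
    fix z assume "z \<in> ?S"
    then obtain u where u: "0 < u" "u < 1"
      "z = (1 - u) *\<^sub>R Complex a (\<beta> + \<gamma> * a) + u *\<^sub>R Complex c (\<beta> + \<gamma> * c)"
      by (auto simp: in_segment)
    have R: "Re z = a + u * (c - a)" and I: "Im z = \<beta> + \<gamma> * (a + u * (c - a))"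
      by (simp_all add: u algebra_simps)
    have "0 < u * (c - a)" "u * (c - a) < 1 * (c - a)"
      using u assms by (simp, intro mult_strict_right_mono) auto
    then show "z \<in> ?T" using R I by auto
  qed
  show "?T \<subseteq> ?S"
  proof
    fix z assume z: "z \<in> ?T"
    define u where "u = (Re z - a) / (c - a)"
    have "0 < u" "u < 1" using z assms by (auto simp: u_def)
    have R: "Re z = a + u * (c - a)" using assms by (simp add: u_def)
    have I: "Im z = \<beta> + \<gamma> * (a + u * (c - a))" using z unfolding R[symmetric] by simp
    have "z = (1 - u) *\<^sub>R Complex a (\<beta> + \<gamma> * a) + u *\<^sub>R Complex c (\<beta> + \<gamma> * c)"
      by (intro complex_eqI) (simp_all add: R I algebra_simps)
    then show "z \<in> ?S" using assms \<open>0 < u\<close> \<open>u < 1\<close> by (auto simp: in_segment)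
  qed
qed

lemma open_segment_vertical:
  fixes a b d :: real
  assumes "b < d"
  shows "open_segment (Complex a b) (Complex a d) = {z. Re z = a \<and> b < Im z \<and> Im z < d}" (is "?S = ?T")
proof
  show "?S \<subseteq> ?T"
  proof
    fix z assume "z \<in> ?S"
    then obtain u where u: "0 < u" "u < 1" "z = (1 - u) *\<^sub>R Complex a b + u *\<^sub>R Complex a d"
      by (auto simp: in_segment)
    have R: "Re z = a" and I: "Im z = b + u * (d - b)"
      by (simp_all add: u algebra_simps)
    have "0 < u * (d - b)" "u * (d - b) < 1 * (d - b)"
      using u assms by (simp, intro mult_strict_right_mono) auto
    then show "z \<in> ?T" using R I by auto
  qed
  show "?T \<subseteq> ?S"
  proof
    fix z assume z: "z \<in> ?T"
    define u where "u = (Im z - b) / (d - b)"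
    have "0 < u" "u < 1" using z assms by (auto simp: u_def)
    moreover have "Im z = b + u * (d - b)" using assms by (simp add: u_def)
    then have "z = (1 - u) *\<^sub>R Complex a b + u *\<^sub>R Complex a d"
      using z by (intro complex_eqI) (simp_all add: algebra_simps)
    ultimately show "z \<in> ?S" using assms by (auto simp: in_segment)
  qed
qed

lemma Complex_in_convex:
  assumes "convex C" "Complex a y \<in> C" "Complex c y' \<in> C" "0 \<le> u" "u \<le> 1"
  shows "Complex (a + u * (c - a)) (y + u * (y' - y)) \<in> C"
proof -
  have "Complex (a + u * (c - a)) (y + u * (y' - y)) = (1 - u) *\<^sub>R Complex a y + u *\<^sub>R Complex c y'"
    by (rule complex_eqI) (simp_all add: algebra_simps)
  also have "\<dots> \<in> C" using assms by (intro convexD) auto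
  finally show ?thesis .
qed

text \<open>Every point lies on a vertical chord between the lower and the upper boundary, and these
  are polygonal paths through the given points.\<close>

lemma cell_subset_convex:
  assumes C: "convex C" and s: "0 \<le> s" "s / 2 < h"
    and top: "Complex (1/2) (h - s/2) \<in> C" "Complex 0 h \<in> C" "Complex (-1/2) (h - s/2) \<in> C"
    and bottom: "Complex (-1/2) (-(h - s/2)) \<in> C" "Complex 0 (-h) \<in> C" "Complex (1/2) (-(h - s/2)) \<in> C"
  shows "cell h s \<subseteq> C"
proof
  fix z assume "z \<in> cell h s"
  then have z: "\<bar>Re z\<bar> \<le> 1/2" "\<bar>Im z\<bar> \<le> h - s * \<bar>Re z\<bar>" by (auto simp: cell_def)
  define t where "t = h - s * \<bar>Re z\<bar>"
  have "s * \<bar>Re z\<bar> \<le> s * (1/2)" using s z by (intro mult_left_mono) auto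
  then have t: "0 < t" using s by (simp add: t_def)
  have up: "Complex (Re z) t \<in> C"
  proof (cases "0 \<le> Re z")
    case True
    then show ?thesis using Complex_in_convex[OF C top(2) top(1), of "2 * Re z"] z
      by (simp add: t_def algebra_simps)
  next
    case False
    then show ?thesis using Complex_in_convex[OF C top(2) top(3), of "- 2 * Re z"] z
      by (simp add: t_def algebra_simps)
  qed
  have down: "Complex (Re z) (-t) \<in> C"
  proof (cases "0 \<le> Re z")
    case True
    then show ?thesis using Complex_in_convex[OF C bottom(2) bottom(3), of "2 * Re z"] z
      by (simp add: t_def algebra_simps)
  next
    case False
    then show ?thesis using Complex_in_convex[OF C bottom(2) bottom(1), of "- 2 * Re z"] z
      by (simp add: t_def algebra_simps)
  qed
  have "Complex (Re z) (-t + (Im z + t) / (2 * t) * (t - -t)) \<in> C"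
    using Complex_in_convex[OF C down up, of "(Im z + t) / (2 * t)"] z t
    by (simp add: t_def[symmetric] divide_le_eq)
  then show "z \<in> C" using t by (simp add: complex_eq_iff[symmetric] complex_surj)
qed

lemma convex_cell:
  assumes "0 \<le> s"
  shows "convex (cell h s)"
proof (rule convexI)
  fix x y :: complex and u v :: real
  assume xy: "x \<in> cell h s" "y \<in> cell h s" and uv: "0 \<le> u" "0 \<le> v" "u + v = 1"
  have R: "\<bar>Re (u *\<^sub>R x + v *\<^sub>R y)\<bar> \<le> u * \<bar>Re x\<bar> + v * \<bar>Re y\<bar>"
    using uv abs_triangle_ineq[of "u * Re x" "v * Re y"] by (simp add: abs_mult)
  have I: "\<bar>Im (u *\<^sub>R x + v *\<^sub>R y)\<bar> \<le> u * \<bar>Im x\<bar> + v * \<bar>Im y\<bar>"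
    using uv abs_triangle_ineq[of "u * Im x" "v * Im y"] by (simp add: abs_mult)
  have "u * \<bar>Re x\<bar> + v * \<bar>Re y\<bar> \<le> 1/2"
    using xy uv by (intro convex_bound_le) (auto simp: cell_def)
  moreover have "u * (\<bar>Im x\<bar> + s * \<bar>Re x\<bar>) + v * (\<bar>Im y\<bar> + s * \<bar>Re y\<bar>) \<le> h"
    using xy uv by (intro convex_bound_le) (auto simp: cell_def)
  moreover have "s * \<bar>Re (u *\<^sub>R x + v *\<^sub>R y)\<bar> \<le> s * (u * \<bar>Re x\<bar> + v * \<bar>Re y\<bar>)"
    using R assms by (rule mult_left_mono)
  ultimately show "u *\<^sub>R x + v *\<^sub>R y \<in> cell h s"
    using R I by (simp add: cell_def algebra_simps)
qed

section \<open>Cells with half of their boundary\<close>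

text \<open>Opposite edges are lattice translates with reversed orientation, so keeping the second
  half of every edge keeps one point of each equivalent pair; one of two opposite midpoints is
  added. The four corners form a single class, hence one kept vertex.\<close>

definition half_open_rectangle :: "real \<Rightarrow> complex set" where
  "half_open_rectangle h = {z. \<bar>Re z\<bar> < 1/2 \<and> \<bar>Im z\<bar> < h}
     \<union> {z. Im z = h \<and> -1/2 \<le> Re z \<and> Re z \<le> 0}
     \<union> {z. Re z = -1/2 \<and> -h < Im z \<and> Im z \<le> 0}
     \<union> {z. 0 < Re z \<and> Re z < 1/2 \<and> Im z = -h}
     \<union> {z. Re z = 1/2 \<and> 0 < Im z \<and> Im z < h}"

text \<open>The six vertices form two classes of three equivalent points. The kept ones are the
  upper apex and the upper left vertex; a closed end of a range is a kept midpoint or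
  vertex.\<close>

definition half_open_hexagon :: "real \<Rightarrow> real \<Rightarrow> complex set" where
  "half_open_hexagon h s = {z. \<bar>Re z\<bar> < 1/2 \<and> \<bar>Im z\<bar> + s * \<bar>Re z\<bar> < h}
     \<union> {z. Im z = h - s * Re z \<and> 0 \<le> Re z \<and> Re z \<le> 1/4}
     \<union> {z. Im z = h + s * Re z \<and> -1/2 \<le> Re z \<and> Re z \<le> -1/4}
     \<union> {z. Re z = -1/2 \<and> -(h - s/2) < Im z \<and> Im z \<le> 0}
     \<union> {z. -1/4 < Re z \<and> Re z < 0 \<and> Im z = -h - s * Re z}
     \<union> {z. 1/4 < Re z \<and> Re z < 1/2 \<and> Im z = -h + s * Re z}
     \<union> {z. Re z = 1/2 \<and> 0 < Im z \<and> Im z < h - s/2}"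

lemma half_open_rectangle_top:
  "0 < h \<Longrightarrow> Im z = h \<Longrightarrow> -1/2 \<le> Re z \<Longrightarrow> Re z \<le> 0 \<Longrightarrow> z \<in> half_open_rectangle h"
  by (simp add: half_open_rectangle_def)

lemma half_open_rectangle_left:
  "0 < h \<Longrightarrow> Re z = -1/2 \<Longrightarrow> -h < Im z \<Longrightarrow> Im z \<le> 0 \<Longrightarrow> z \<in> half_open_rectangle h"
  by (simp add: half_open_rectangle_def)

lemma half_open_hexagonI:
  shows "\<bar>Re z\<bar> < 1/2 \<Longrightarrow> \<bar>Im z\<bar> + s * \<bar>Re z\<bar> < h \<Longrightarrow> z \<in> half_open_hexagon h s"
    and "Im z = h - s * Re z \<Longrightarrow> 0 \<le> Re z \<Longrightarrow> Re z \<le> 1/4 \<Longrightarrow> z \<in> half_open_hexagon h s"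
    and "Im z = h + s * Re z \<Longrightarrow> -1/2 \<le> Re z \<Longrightarrow> Re z \<le> -1/4 \<Longrightarrow> z \<in> half_open_hexagon h s"
    and "Re z = -1/2 \<Longrightarrow> -(h - s/2) < Im z \<Longrightarrow> Im z \<le> 0 \<Longrightarrow> z \<in> half_open_hexagon h s"
    and "Im z = -h - s * Re z \<Longrightarrow> -1/4 < Re z \<Longrightarrow> Re z < 0 \<Longrightarrow> z \<in> half_open_hexagon h s"
    and "Im z = -h + s * Re z \<Longrightarrow> 1/4 < Re z \<Longrightarrow> Re z < 1/2 \<Longrightarrow> z \<in> half_open_hexagon h s"
    and "Re z = 1/2 \<Longrightarrow> 0 < Im z \<Longrightarrow> Im z < h - s/2 \<Longrightarrow> z \<in> half_open_hexagon h s"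
  unfolding half_open_hexagon_def Un_iff mem_Collect_eq by blast+

text \<open>Here \<open>\<alpha>\<close> is the argument of the vertex
  \<open>Complex (1/2) y\<close>; the other vertices off the imaginary axis are its
  reflections.\<close>

lemma polar_form_half:
  fixes y :: real
  assumes "0 < y"
  obtains r \<alpha> where "0 < r" "0 < \<alpha>" "\<alpha> < pi / 2" "r * cos \<alpha> = 1/2" "r * sin \<alpha> = y" "r\<^sup>2 = 1/4 + y\<^sup>2"
proof
  let ?r = "sqrt (1 + (2 * y)\<^sup>2) / 2" and ?\<alpha> = "arctan (2 * y)"
  have pos: "0 < 1 + (2 * y)\<^sup>2" by (simp add: add_pos_nonneg)
  show "0 < ?r" using pos by simp
  show "0 < ?\<alpha>" "?\<alpha> < pi / 2" using assms arctan_ubound by auto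
  show "?r * cos ?\<alpha> = 1/2" "?r * sin ?\<alpha> = y"
    using pos by (simp_all add: cos_arctan sin_arctan)
  show "?r\<^sup>2 = 1/4 + y\<^sup>2" using pos by (simp add: power_divide power2_eq_square)
qed

lemma cmod_Complex_eqI: "cmod (Complex a b) = r" if "a\<^sup>2 + b\<^sup>2 = r\<^sup>2" "0 \<le> r"
  using that by (simp add: cmod_def)

lemma restricted_voronoi_rectangle:
  assumes vor: "voronoi \<tau> = cell h 0" and h: "0 < h"
  shows "restricted_voronoi \<tau> = half_open_rectangle h"
proof -
  obtain r \<alpha> where r: "0 < r" and \<alpha>: "0 < \<alpha>" "\<alpha> < pi / 2"
    and rc: "r * cos \<alpha> = 1/2" "r * sin \<alpha> = h" and r2: "r\<^sup>2 = 1/4 + h\<^sup>2"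
    by (rule polar_form_half[OF h])
  define vs where "vs = [Complex (1/2) h, Complex (-1/2) h, Complex (-1/2) (-h), Complex (1/2) (-h)]"
  define \<theta> where "\<theta> k = [\<alpha>, pi - \<alpha>, pi + \<alpha>, 2 * pi - \<alpha>] ! k" for k
  have lt4: "{..<4::nat} = {0, 1, 2, 3}" by auto
  have polar: "of_real r * cis (\<theta> k) = vs ! k" if "k < 4" for k
  proof -
    have "k \<in> {0, 1, 2, 3}" using that lt4 by blast
    then show ?thesis using rc by (auto simp: \<theta>_def vs_def complex_eq_iff)
  qed
  have "voronoi \<tau> = convex hull (set vs)"
  proof
    have S: "x \<in> convex hull (set vs)" if "x \<in> set vs" for x using that by (rule hull_inc)
    \<comment> \<open>The points on the imaginary axis demanded by \<open>cell_subset_convex\<close>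
      are midpoints of the horizontal edges when \<open>s = 0\<close>.\<close>
    have "Complex 0 h \<in> convex hull (set vs)" "Complex 0 (-h) \<in> convex hull (set vs)"
      using Complex_in_convex[OF convex_convex_hull, of "-1/2" h "set vs" "1/2" h "1/2"]
        Complex_in_convex[OF convex_convex_hull, of "-1/2" "-h" "set vs" "1/2" "-h" "1/2"] S
      by (simp_all add: vs_def)
    then show "voronoi \<tau> \<subseteq> convex hull (set vs)"
      unfolding vor using h S by (intro cell_subset_convex) (auto simp: vs_def)
    show "convex hull (set vs) \<subseteq> voronoi \<tau>"
      unfolding vor using h by (intro hull_minimal convex_cell) (auto simp: vs_def cell_def)
  qed
  moreover have "set vs \<subseteq> sphere 0 r"
    using r r2 by (auto simp: vs_def power2_eq_square intro!: cmod_Complex_eqI)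
  ultimately have V: "vor_vertices \<tau> = set vs"
    unfolding vor_vertices_def by (simp add: extreme_points_convex_hull_on_sphere)
  also have "set vs = (\<lambda>k. vs ! k) ` {..<4}" by (auto simp: lt4 vs_def)
  also have "\<dots> = (\<lambda>k. of_real r * cis (\<theta> k)) ` {..<4}"
    using polar by (intro image_cong) auto
  finally have V': "vor_vertices \<tau> = (\<lambda>k. of_real r * cis (\<theta> k)) ` {..<4}" .
  have "vor_vertex0 \<tau> = vs ! 0"
    unfolding vor_vertex0_def V by (rule the_equality) (use h in \<open>auto simp: vs_def\<close>)
  then have v0: "vor_vertex0 \<tau> = of_real r * cis (\<theta> 0)" using polar[of 0] by simp
  have mono: "strict_mono_on {..<4} \<theta>"
    unfolding lt4 using \<alpha> by (auto simp: strict_mono_on_def \<theta>_def)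
  have turn: "\<theta> k < \<theta> 0 + 2 * pi" if "k < 4" for k
  proof -
    have "k \<in> {0, 1, 2, 3}" using that lt4 by blast
    then show ?thesis using \<alpha> by (auto simp: \<theta>_def)
  qed
  have count: "vor_count \<tau> = 4"
    by (rule vor_count_polar[OF _ r V' v0 mono turn]) auto
  have vertex: "vor_vertex \<tau> k = vs ! (k mod 4)" for k
    using vor_vertex_polar[OF _ r V' v0 mono turn, of k] polar[of "k mod 4"] by simp
  have sub: "{0..<4::nat} = {0, 1, 2, 3}" "{0..<4 div 2::nat} = {0, 1}" "{1..4 div 3::nat} = {1}"
    by auto
  have mids: "vor_midpoint \<tau> 0 = Complex 0 h" "vor_midpoint \<tau> 1 = Complex (-1/2) 0"
    "vor_midpoint \<tau> 2 = Complex 0 (-h)" "vor_midpoint \<tau> 3 = Complex (1/2) 0"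
    by (simp_all add: vor_midpoint_def vertex vs_def midpoint_def complex_eq_iff)
  have segs:
    "open_segment (vor_midpoint \<tau> 0) (vor_vertex \<tau> (0 + 1)) = {z. -1/2 < Re z \<and> Re z < 0 \<and> Im z = h}"
    "open_segment (vor_midpoint \<tau> 1) (vor_vertex \<tau> (1 + 1)) = {z. Re z = -1/2 \<and> -h < Im z \<and> Im z < 0}"
    "open_segment (vor_midpoint \<tau> 2) (vor_vertex \<tau> (2 + 1)) = {z. 0 < Re z \<and> Re z < 1/2 \<and> Im z = -h}"
    "open_segment (vor_midpoint \<tau> 3) (vor_vertex \<tau> (3 + 1)) = {z. Re z = 1/2 \<and> 0 < Im z \<and> Im z < h}"
    unfolding mids vertex
    using h open_segment_graph[of "-1/2" 0 h 0] open_segment_graph[of 0 "1/2" "-h" 0]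
      open_segment_vertical[of "-h" 0 "-1/2"] open_segment_vertical[of 0 h "1/2"]
    by (simp_all add: vs_def open_segment_commute)
  have pieces:
    "{z. Im z = h \<and> -1/2 \<le> Re z \<and> Re z \<le> 0} =
      {z. -1/2 < Re z \<and> Re z < 0 \<and> Im z = h} \<union> {Complex 0 h, Complex (-1/2) h}"
    "{z. Re z = -1/2 \<and> -h < Im z \<and> Im z \<le> 0} =
      {z. Re z = -1/2 \<and> -h < Im z \<and> Im z < 0} \<union> {Complex (-1/2) 0}"
    using h by (auto simp: complex_eq_iff)
  have verts: "vor_vertex \<tau> 1 = Complex (-1/2) h" by (simp add: vertex vs_def)
  show ?thesis
    unfolding restricted_voronoi_def count sub UN_insert UN_empty segs
    unfolding image_insert image_empty mids verts vor interior_cell[OF h] half_open_rectangle_def pieces mult_zero_left add_0_right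
    by (simp only: Un_insert_left Un_insert_right Un_empty_left Un_empty_right Un_ac insert_commute)
qed

text \<open>By \<open>circ\<close> the apexes and the remaining four vertices lie on one circle
  around 0. The apexes thus get the common polar radius \<open>r = h\<close>, and the sphere
  criterion for extreme points applies.\<close>

lemma restricted_voronoi_hexagon:
  assumes vor: "voronoi \<tau> = cell h s" and s: "0 < s" "s / 2 < h" and circ: "h\<^sup>2 = 1/4 + (h - s/2)\<^sup>2"
  shows "restricted_voronoi \<tau> = half_open_hexagon h s"
proof -
  define y where "y = h - s/2"
  have y: "0 < y" "y < h" using s by (simp_all add: y_def)
  have h: "0 < h" using s by simp
  obtain r \<alpha> where r: "0 < r" and \<alpha>: "0 < \<alpha>" "\<alpha> < pi / 2"
    and rc: "r * cos \<alpha> = 1/2" "r * sin \<alpha> = y" and r2: "r\<^sup>2 = 1/4 + y\<^sup>2"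
    by (rule polar_form_half[OF y(1)])
  have "r\<^sup>2 = h\<^sup>2" unfolding r2 circ y_def ..
  then have "r = h" using r h by (simp add: power2_eq_imp_eq)
  define vs where "vs = [Complex (1/2) y, Complex 0 h, Complex (-1/2) y,
    Complex (-1/2) (-y), Complex 0 (-h), Complex (1/2) (-y)]"
  define \<theta> where "\<theta> k = [\<alpha>, pi / 2, pi - \<alpha>, pi + \<alpha>, pi + pi / 2, 2 * pi - \<alpha>] ! k" for k
  have lt6: "{..<6::nat} = {0, 1, 2, 3, 4, 5}" by auto
  have polar: "of_real r * cis (\<theta> k) = vs ! k" if "k < 6" for k
  proof -
    have "k \<in> {0, 1, 2, 3, 4, 5}" using that lt6 by blast
    moreover have "cos (3 * pi / 2) = 0" "sin (3 * pi / 2) = -1"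
      using cos_3over2_pi sin_3over2_pi by simp_all
    ultimately show ?thesis using rc \<open>r = h\<close> by (auto simp: \<theta>_def vs_def complex_eq_iff)
  qed
  have "voronoi \<tau> = convex hull (set vs)"
  proof
    have S: "x \<in> convex hull (set vs)" if "x \<in> set vs" for x using that by (rule hull_inc)
    show "voronoi \<tau> \<subseteq> convex hull (set vs)"
      unfolding vor using s S by (intro cell_subset_convex) (auto simp: vs_def y_def)
    show "convex hull (set vs) \<subseteq> voronoi \<tau>"
      unfolding vor using s y
      by (intro hull_minimal convex_cell) (auto simp: vs_def cell_def y_def)
  qed
  moreover have "set vs \<subseteq> sphere 0 r"
    using r r2 \<open>r = h\<close>
    by (auto simp: vs_def power2_eq_square intro!: cmod_Complex_eqI)
  ultimately have V: "vor_vertices \<tau> = set vs"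
    unfolding vor_vertices_def by (simp add: extreme_points_convex_hull_on_sphere)
  also have "set vs = (\<lambda>k. vs ! k) ` {..<6}" by (auto simp: lt6 vs_def)
  also have "\<dots> = (\<lambda>k. of_real r * cis (\<theta> k)) ` {..<6}"
    using polar by (intro image_cong) auto
  finally have V': "vor_vertices \<tau> = (\<lambda>k. of_real r * cis (\<theta> k)) ` {..<6}" .
  have "vor_vertex0 \<tau> = vs ! 0"
    unfolding vor_vertex0_def V by (rule the_equality) (use y in \<open>auto simp: vs_def\<close>)
  then have v0: "vor_vertex0 \<tau> = of_real r * cis (\<theta> 0)" using polar[of 0] by simp
  have mono: "strict_mono_on {..<6} \<theta>"
    unfolding lt6 using \<alpha> by (auto simp: strict_mono_on_def \<theta>_def)
  have turn: "\<theta> k < \<theta> 0 + 2 * pi" if "k < 6" for k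
  proof -
    have "k \<in> {0, 1, 2, 3, 4, 5}" using that lt6 by blast
    then show ?thesis using \<alpha> by (auto simp: \<theta>_def)
  qed
  have count: "vor_count \<tau> = 6"
    by (rule vor_count_polar[OF _ r V' v0 mono turn]) auto
  have vertex: "vor_vertex \<tau> k = vs ! (k mod 6)" for k
    using vor_vertex_polar[OF _ r V' v0 mono turn, of k] polar[of "k mod 6"] by simp
  have sub: "{0..<6::nat} = {0, 1, 2, 3, 4, 5}" "{0..<6 div 2::nat} = {0, 1, 2}" "{1..6 div 3::nat} = {1, 2}"
    by auto
  have mids: "vor_midpoint \<tau> 0 = Complex (1/4) (h - s/4)" "vor_midpoint \<tau> 1 = Complex (-1/4) (h - s/4)"
    "vor_midpoint \<tau> 2 = Complex (-1/2) 0" "vor_midpoint \<tau> 3 = Complex (-1/4) (-h + s/4)"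
    "vor_midpoint \<tau> 4 = Complex (1/4) (-h + s/4)" "vor_midpoint \<tau> 5 = Complex (1/2) 0"
    by (simp_all add: vor_midpoint_def vertex vs_def midpoint_def complex_eq_iff y_def)
  have segs:
    "open_segment (vor_midpoint \<tau> 0) (vor_vertex \<tau> (0 + 1)) = {z. 0 < Re z \<and> Re z < 1/4 \<and> Im z = h - s * Re z}"
    "open_segment (vor_midpoint \<tau> 1) (vor_vertex \<tau> (1 + 1)) = {z. -1/2 < Re z \<and> Re z < -1/4 \<and> Im z = h + s * Re z}"
    "open_segment (vor_midpoint \<tau> 2) (vor_vertex \<tau> (2 + 1)) = {z. Re z = -1/2 \<and> -y < Im z \<and> Im z < 0}"
    "open_segment (vor_midpoint \<tau> 3) (vor_vertex \<tau> (3 + 1)) = {z. -1/4 < Re z \<and> Re z < 0 \<and> Im z = -h - s * Re z}"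
    "open_segment (vor_midpoint \<tau> 4) (vor_vertex \<tau> (4 + 1)) = {z. 1/4 < Re z \<and> Re z < 1/2 \<and> Im z = -h + s * Re z}"
    "open_segment (vor_midpoint \<tau> 5) (vor_vertex \<tau> (5 + 1)) = {z. Re z = 1/2 \<and> 0 < Im z \<and> Im z < y}"
    unfolding mids vertex
    using y open_segment_graph[of 0 "1/4" h "-s"] open_segment_graph[of "-1/2" "-1/4" h s]
      open_segment_graph[of "-1/4" 0 "-h" "-s"] open_segment_graph[of "1/4" "1/2" "-h" s]
      open_segment_vertical[of "-y" 0 "-1/2"] open_segment_vertical[of 0 y "1/2"]
    by (simp_all add: vs_def open_segment_commute y_def)
  have pieces:
    "{z. Im z = h - s * Re z \<and> 0 \<le> Re z \<and> Re z \<le> 1/4} =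
      {z. 0 < Re z \<and> Re z < 1/4 \<and> Im z = h - s * Re z} \<union> {Complex (1/4) (h - s/4), Complex 0 h}"
    "{z. Im z = h + s * Re z \<and> -1/2 \<le> Re z \<and> Re z \<le> -1/4} =
      {z. -1/2 < Re z \<and> Re z < -1/4 \<and> Im z = h + s * Re z} \<union> {Complex (-1/4) (h - s/4), Complex (-1/2) y}"
    "{z. Re z = -1/2 \<and> -y < Im z \<and> Im z \<le> 0} =
      {z. Re z = -1/2 \<and> -y < Im z \<and> Im z < 0} \<union> {Complex (-1/2) 0}"
    using y by (auto simp: complex_eq_iff y_def)
  have verts: "vor_vertex \<tau> 1 = Complex 0 h" "vor_vertex \<tau> 2 = Complex (-1/2) y"
    by (simp_all add: vertex vs_def)
  show ?thesis
    unfolding restricted_voronoi_def count sub UN_insert UN_empty segs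
    unfolding image_insert image_empty mids verts vor interior_cell[OF h] half_open_hexagon_def y_def[symmetric] pieces
    by (simp only: Un_insert_left Un_insert_right Un_empty_left Un_empty_right Un_ac insert_commute)
qed

section \<open>Rectangular and rhombic lattices\<close>

definition rect_lattice :: "real \<Rightarrow> complex set" where
  "rect_lattice b = {Complex (of_int m) (of_int n * b) | m n. True}"

definition rhombic_lattice :: "real \<Rightarrow> complex set" where
  "rhombic_lattice b = {Complex (of_int m + of_int n / 2) (of_int n * b) | m n. True}"

lemma cmod_le_cmod_diff_iff:
  "cmod z \<le> cmod (z - y) \<longleftrightarrow> 2 * (Re z * Re y + Im z * Im y) \<le> (Re y)\<^sup>2 + (Im y)\<^sup>2"
proof -
  have "cmod z \<le> cmod (z - y) \<longleftrightarrow> (cmod z)\<^sup>2 \<le> (cmod (z - y))\<^sup>2"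
    by (metis norm_ge_zero power2_le_imp_le power_mono)
  then show ?thesis unfolding cmod_power2 by (simp add: power2_diff) argo
qed

lemma abs_le_square_int: "\<bar>real_of_int m\<bar> \<le> (real_of_int m)\<^sup>2"
proof -
  have "\<bar>m\<bar> * 1 \<le> \<bar>m\<bar> * \<bar>m\<bar>" if "m \<noteq> 0" using that by (intro mult_left_mono) auto
  then have "\<bar>m\<bar> \<le> m\<^sup>2" by (cases "m = 0") (auto simp: power2_eq_square)
  then show ?thesis by (metis of_int_abs of_int_le_iff of_int_power)
qed

text \<open>The four nearest neighbours of 0 cut out the rectangle. Other lattice points impose
  nothing more: the inequality splits into coordinates, where
  \<open>\<bar>m\<bar> \<le> m\<^sup>2\<close> for integers.\<close>

lemma voronoi_rectangle:
  assumes L: "zring \<tau> = rect_lattice b" and b: "0 < b"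
  shows "voronoi \<tau> = cell (b/2) 0"
proof
  show "voronoi \<tau> \<subseteq> cell (b/2) 0"
  proof
    fix z assume "z \<in> voronoi \<tau>"
    then have *: "2 * (Re z * real_of_int m + Im z * (real_of_int n * b)) \<le> (real_of_int m)\<^sup>2 + (real_of_int n * b)\<^sup>2" for m n
      unfolding voronoi_def L rect_lattice_def cmod_le_cmod_diff_iff by force
    have "b * (2 * Im z) \<le> b * b" "b * (- 2 * Im z) \<le> b * b"
      using *[of 0 1] *[of 0 "-1"] by (auto simp: power2_eq_square mult_ac)
    then have "2 * Im z \<le> b" "- 2 * Im z \<le> b" using b mult_left_le_imp_le by blast+
    then have "\<bar>Im z\<bar> \<le> b/2" by auto
    then show "z \<in> cell (b/2) 0" using *[of 1 0] *[of "-1" 0] by (auto simp: cell_def)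
  qed
  show "cell (b/2) 0 \<subseteq> voronoi \<tau>"
  proof
    fix z assume "z \<in> cell (b/2) 0"
    then have z: "\<bar>Re z\<bar> \<le> 1/2" "\<bar>Im z\<bar> \<le> b/2" by (auto simp: cell_def)
    have "2 * (Re z * real_of_int m + Im z * (real_of_int n * b)) \<le> (real_of_int m)\<^sup>2 + (real_of_int n * b)\<^sup>2" for m n
    proof -
      have "Re z * real_of_int m \<le> 1/2 * \<bar>real_of_int m\<bar>"
        using z by (metis abs_ge_self abs_ge_zero abs_mult mult_right_mono order_trans)
      moreover have "\<bar>Im z\<bar> * \<bar>real_of_int n\<bar> * b \<le> (b/2) * \<bar>real_of_int n\<bar> * b"
        using z b by (intro mult_right_mono) auto
      then have "Im z * (real_of_int n * b) \<le> b\<^sup>2 * \<bar>real_of_int n\<bar> / 2"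
        using b abs_ge_self[of "Im z * (real_of_int n * b)"] by (simp add: abs_mult power2_eq_square mult_ac)
      moreover have "b\<^sup>2 * \<bar>real_of_int n\<bar> \<le> b\<^sup>2 * (real_of_int n)\<^sup>2"
        using abs_le_square_int by (intro mult_left_mono) auto
      ultimately show ?thesis using abs_le_square_int[of m] by (simp add: power_mult_distrib mult.commute)
    qed
    then show "z \<in> voronoi \<tau>"
      unfolding voronoi_def L rect_lattice_def cmod_le_cmod_diff_iff by auto
  qed
qed

text \<open>For a cell point with absolute real part \<open>x\<close> and a lattice point in row
  \<open>n\<close> with absolute real part \<open>u\<close>, the left side bounds their inner
  product and the right side is half the squared norm of the lattice point, with
  \<open>\<beta>\<close> for \<open>b\<^sup>2\<close>. So no lattice point cuts into the
  hexagon.\<close>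

lemma rhombic_form_bound:
  fixes x \<beta> :: real and m n :: int
  assumes x: "0 \<le> x" "x \<le> 1/2" and \<beta>: "3/4 \<le> \<beta>"
  defines "u \<equiv> \<bar>of_int m + of_int n / 2 :: real\<bar>"
  shows "x * u + \<bar>of_int n\<bar> * (\<beta>/2 + 1/8 - x/2) \<le> (u\<^sup>2 + (of_int n)\<^sup>2 * \<beta>) / 2"
proof -
  consider "n = 0" | "\<bar>n\<bar> = 1" | "\<bar>n\<bar> \<ge> 2" by linarith
  then show ?thesis
  proof cases
    case 1
    have "x * u \<le> 1/2 * u" using x by (intro mult_right_mono) (auto simp: u_def)
    then show ?thesis using abs_le_square_int[of m] 1 by (simp add: u_def)
  next
    case 2
    \<comment> \<open>In the rows next to the axis the real part is a half-integer, so
      \<open>u\<close> is at least \<open>1/2\<close>; the value \<open>1/2\<close> belongs to the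
      neighbours that define the roof.\<close>
    have "odd (2 * m + n)" using 2 by presburger
    then have "1 \<le> \<bar>2 * m + n\<bar>" by presburger
    then have "1 \<le> \<bar>real_of_int (2 * m + n)\<bar>" by linarith
    then have u: "1/2 \<le> u" by (simp add: u_def abs_if split: if_splits)
    have "x * (u - 1/2) \<le> 1/2 * (u - 1/2)" using x u by (intro mult_right_mono) auto
    moreover have "0 \<le> (u - 1/2)\<^sup>2" by simp
    moreover have n: "\<bar>real_of_int n\<bar> = 1" "(real_of_int n)\<^sup>2 = 1"
      using 2 by (metis of_int_1 of_int_abs, metis 2 of_int_1 of_int_abs power2_abs power_one)
    ultimately show ?thesis unfolding n by (simp add: power2_eq_square algebra_simps)
  next
    case 3
    \<comment> \<open>Completing the square gives
      \<open>x * u \<le> (u\<^sup>2 + x\<^sup>2) / 2\<close>, and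
      \<open>x\<^sup>2 \<le> k * x\<close> cancels the term with \<open>x / 2\<close>. What remains
      is \<open>k / 8 \<le> k * (k - 1) * \<beta> / 2\<close>.\<close>
    define k where "k = \<bar>real_of_int n\<bar>"
    have k: "2 \<le> k" using 3 by (simp add: k_def)
    have "k / 8 \<le> k * (k - 1) * (3/4) / 2" using k mult_left_mono[of 2 k "k"] by (simp add: algebra_simps)
    also have "\<dots> \<le> k * (k - 1) * \<beta> / 2" using k \<beta> by (intro divide_right_mono mult_left_mono) auto
    finally have 1: "k / 8 \<le> k * (k - 1) * \<beta> / 2" .
    have "x * x \<le> k * x" using x k by (intro mult_right_mono) auto
    moreover have "0 \<le> (u - x)\<^sup>2" by simp
    moreover have "(real_of_int n)\<^sup>2 = k * k" by (simp add: k_def flip: power2_eq_square)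
    ultimately show ?thesis using 1 unfolding k_def[symmetric]
      by (simp add: power2_eq_square algebra_simps)
  qed
qed

text \<open>The bisector of 0 and \<open>Complex (1/2) b\<close> is
  \<open>Re z / 2 + b * Im z = b\<^sup>2/2 + 1/8\<close>; its height at \<open>Re z = 0\<close> and
  its slope are the two parameters.\<close>

lemma voronoi_hexagon:
  assumes L: "zring \<tau> = rhombic_lattice b" and b: "0 < b" "3/4 \<le> b\<^sup>2"
  shows "voronoi \<tau> = cell (b/2 + 1/(8*b)) (1/(2*b))"
proof
  have bound_iff: "\<bar>Im z\<bar> + 1/(2*b) * \<bar>Re z\<bar> \<le> b/2 + 1/(8*b) \<longleftrightarrow>
      b * \<bar>Im z\<bar> \<le> b\<^sup>2/2 + 1/8 - \<bar>Re z\<bar>/2" for z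
  proof -
    have "\<bar>Im z\<bar> + 1/(2*b) * \<bar>Re z\<bar> \<le> b/2 + 1/(8*b) \<longleftrightarrow>
        b * (\<bar>Im z\<bar> + 1/(2*b) * \<bar>Re z\<bar>) \<le> b * (b/2 + 1/(8*b))"
      using b by simp
    also have "b * (\<bar>Im z\<bar> + 1/(2*b) * \<bar>Re z\<bar>) = b * \<bar>Im z\<bar> + \<bar>Re z\<bar>/2"
      using b by (simp add: distrib_left)
    also have "b * (b/2 + 1/(8*b)) = b\<^sup>2/2 + 1/8"
      using b by (simp add: distrib_left power2_eq_square)
    finally show ?thesis by argo
  qed
  show "voronoi \<tau> \<subseteq> cell (b/2 + 1/(8*b)) (1/(2*b))"
  proof
    fix z assume "z \<in> voronoi \<tau>"
    then have *: "2 * (Re z * (real_of_int m + real_of_int n / 2) + Im z * (real_of_int n * b))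
        \<le> (real_of_int m + real_of_int n / 2)\<^sup>2 + (real_of_int n * b)\<^sup>2" for m n
      unfolding voronoi_def L rhombic_lattice_def cmod_le_cmod_diff_iff by force
    have "b * \<bar>Im z\<bar> \<le> b\<^sup>2/2 + 1/8 - \<bar>Re z\<bar>/2"
      using *[of 0 1] *[of "-1" 1] *[of 0 "-1"] *[of 1 "-1"]
      by (cases "0 \<le> Re z"; cases "0 \<le> Im z") (auto simp: power2_eq_square algebra_simps)
    then show "z \<in> cell (b/2 + 1/(8*b)) (1/(2*b))"
      using *[of 1 0] *[of "-1" 0] unfolding cell_def mem_Collect_eq bound_iff by auto
  qed
  show "cell (b/2 + 1/(8*b)) (1/(2*b)) \<subseteq> voronoi \<tau>"
  proof
    fix z assume "z \<in> cell (b/2 + 1/(8*b)) (1/(2*b))"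
    then have z: "\<bar>Re z\<bar> \<le> 1/2" "b * \<bar>Im z\<bar> \<le> b\<^sup>2/2 + 1/8 - \<bar>Re z\<bar>/2"
      unfolding cell_def mem_Collect_eq bound_iff by auto
    have "2 * (Re z * (real_of_int m + real_of_int n / 2) + Im z * (real_of_int n * b))
        \<le> (real_of_int m + real_of_int n / 2)\<^sup>2 + (real_of_int n * b)\<^sup>2" for m n
    proof -
      have "Re z * (real_of_int m + real_of_int n / 2) \<le> \<bar>Re z\<bar> * \<bar>real_of_int m + real_of_int n / 2\<bar>"
        by (metis abs_ge_self abs_mult)
      moreover have "Im z * (real_of_int n * b) \<le> \<bar>real_of_int n\<bar> * (b * \<bar>Im z\<bar>)"
        using b abs_ge_self[of "Im z * (real_of_int n * b)"] by (simp add: abs_mult mult_ac)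
      moreover have "\<bar>real_of_int n\<bar> * (b * \<bar>Im z\<bar>) \<le> \<bar>real_of_int n\<bar> * (b\<^sup>2/2 + 1/8 - \<bar>Re z\<bar>/2)"
        using z by (intro mult_left_mono) auto
      moreover note rhombic_form_bound[OF abs_ge_zero z(1) b(2), of m n]
      ultimately show ?thesis by (simp add: power_mult_distrib)
    qed
    then show "z \<in> voronoi \<tau>"
      unfolding voronoi_def L rhombic_lattice_def cmod_le_cmod_diff_iff by auto
  qed
qed

section \<open>Tiling the plane by half-open cells\<close>

lemma half_open_rectangle_subset_cell:
  assumes "0 < h"
  shows "half_open_rectangle h \<subseteq> cell h 0"
  using assms by (auto simp: half_open_rectangle_def cell_def)

text \<open>The products \<open>s * Re z\<close> and \<open>s * \<bar>Re z\<bar>\<close> are named so that membership becomes linear arithmetic.\<close>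

lemma half_open_hexagon_linear:
  assumes "0 < s" and z: "z \<in> half_open_hexagon h s"
  obtains a t where "a = s * \<bar>Re z\<bar>" "0 \<le> a" "a \<le> s / 2" "0 \<le> Re z \<longrightarrow> a = t" "Re z \<le> 0 \<longrightarrow> a = - t"
    "Re z = 1/2 \<or> Re z = -1/2 \<longrightarrow> a = s / 2" "-1/2 \<le> Re z" "Re z \<le> 1/2"
    "-1/2 < Re z \<and> Re z < 1/2 \<and> \<bar>Im z\<bar> + a < h \<or> Im z = h - t \<and> 0 \<le> Re z \<and> Re z \<le> 1/4 \<or>
     Im z = h + t \<and> -1/2 \<le> Re z \<and> Re z \<le> -1/4 \<or> Re z = -1/2 \<and> -(h - s/2) < Im z \<and> Im z \<le> 0 \<or>
     -1/4 < Re z \<and> Re z < 0 \<and> Im z = -h - t \<or> 1/4 < Re z \<and> Re z < 1/2 \<and> Im z = -h + t \<or>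
     Re z = 1/2 \<and> 0 < Im z \<and> Im z < h - s/2"
proof
  have R: "\<bar>Re z\<bar> \<le> 1/2" using z by (auto simp: half_open_hexagon_def)
  then show "-1/2 \<le> Re z" "Re z \<le> 1/2" by auto
  show "s * \<bar>Re z\<bar> \<le> s / 2" using mult_left_mono[OF R, of s] assms by simp
  have "\<bar>Re z\<bar> < 1/2 \<longleftrightarrow> -1/2 < Re z \<and> Re z < 1/2" by auto
  then show "-1/2 < Re z \<and> Re z < 1/2 \<and> \<bar>Im z\<bar> + s * \<bar>Re z\<bar> < h \<or> Im z = h - s * Re z \<and> 0 \<le> Re z \<and> Re z \<le> 1/4 \<or>
     Im z = h + s * Re z \<and> -1/2 \<le> Re z \<and> Re z \<le> -1/4 \<or> Re z = -1/2 \<and> -(h - s/2) < Im z \<and> Im z \<le> 0 \<or>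
     -1/4 < Re z \<and> Re z < 0 \<and> Im z = -h - s * Re z \<or> 1/4 < Re z \<and> Re z < 1/2 \<and> Im z = -h + s * Re z \<or>
     Re z = 1/2 \<and> 0 < Im z \<and> Im z < h - s/2"
    using z unfolding half_open_hexagon_def Un_iff mem_Collect_eq by blast
qed (use assms in auto)

lemma half_open_hexagon_subset_cell:
  assumes s: "0 < s" "s / 2 < h"
  shows "half_open_hexagon h s \<subseteq> cell h s"
proof
  fix z assume z: "z \<in> half_open_hexagon h s"
  then obtain a t where a: "a = s * \<bar>Re z\<bar>" and *: "0 \<le> a" "a \<le> s / 2" "0 \<le> Re z \<longrightarrow> a = t"
    "Re z \<le> 0 \<longrightarrow> a = - t" "Re z = 1/2 \<or> Re z = -1/2 \<longrightarrow> a = s / 2" "-1/2 \<le> Re z" "Re z \<le> 1/2"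
    "-1/2 < Re z \<and> Re z < 1/2 \<and> \<bar>Im z\<bar> + a < h \<or> Im z = h - t \<and> 0 \<le> Re z \<and> Re z \<le> 1/4 \<or>
     Im z = h + t \<and> -1/2 \<le> Re z \<and> Re z \<le> -1/4 \<or> Re z = -1/2 \<and> -(h - s/2) < Im z \<and> Im z \<le> 0 \<or>
     -1/4 < Re z \<and> Re z < 0 \<and> Im z = -h - t \<or> 1/4 < Re z \<and> Re z < 1/2 \<and> Im z = -h + t \<or>
     Re z = 1/2 \<and> 0 < Im z \<and> Im z < h - s/2"
    by (rule half_open_hexagon_linear[OF s(1)])
  have "\<bar>Im z\<bar> + a \<le> h" using s * by (cases "0 \<le> Im z"; cases "0 \<le> Re z"; simp; argo)
  then show "z \<in> cell h s" using * by (auto simp: cell_def a)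
qed

lemma half_open_rectangle_covers:
  assumes b: "0 < b"
  shows "\<exists>y \<in> rect_lattice b. z - y \<in> half_open_rectangle (b/2)"
proof -
  define m where "m = \<lfloor>Re z + 1/2\<rfloor>"
  define n where "n = \<lceil>Im z / b - 1/2\<rceil>"
  define X where "X = Re z - of_int m"
  define Y where "Y = Im z - of_int n * b"
  have X: "-1/2 \<le> X" "X < 1/2" unfolding X_def m_def by linarith+
  have "Im z / b - 1/2 \<le> of_int n" "of_int n < Im z / b + 1/2" unfolding n_def by linarith+
  then have Y: "-(b/2) < Y" "Y \<le> b/2" unfolding Y_def using b by (auto simp: field_simps)
  have mem: "Complex (of_int m') (of_int n' * b) \<in> rect_lattice b" for m' n'
    by (auto simp: rect_lattice_def)
  \<comment> \<open>Rounding leaves the left and the top edge. Of these only the upper half of the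
    left edge and the right half of the top edge lie outside the kept boundary; one generator
    carries each of them to the opposite edge.\<close>
  consider "X = -1/2 \<and> 0 < Y \<and> Y < b/2" | "Y = b/2 \<and> 0 < X"
    | "\<not> (X = -1/2 \<and> 0 < Y \<and> Y < b/2)" "\<not> (Y = b/2 \<and> 0 < X)" by blast
  then show ?thesis
  proof cases
    case 1
    then show ?thesis using X_def Y_def
      by (intro bexI[OF _ mem[of "m - 1" n]]) (simp add: half_open_rectangle_def)
  next
    case 2
    then show ?thesis using X_def Y_def X
      by (intro bexI[OF _ mem[of m "n + 1"]]) (simp add: half_open_rectangle_def algebra_simps)
  next
    case 3
    then have "Complex X Y \<in> half_open_rectangle (b/2)"
      using X Y unfolding half_open_rectangle_def by auto
    moreover have "z - Complex (of_int m) (of_int n * b) = Complex X Y"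
      by (simp add: X_def Y_def complex_eq_iff)
    ultimately show ?thesis using mem by metis
  qed
qed

text \<open>In the closed rectangle only translations with \<open>m\<close> and \<open>n\<close> in
  \<open>{-1, 0, 1}\<close> are possible, and a nonzero one would put the points on opposite sides,
  whose kept parts are not equivalent.\<close>

lemma half_open_rectangle_unique:
  assumes b: "0 < b" and z: "z1 \<in> half_open_rectangle (b/2)" "z2 \<in> half_open_rectangle (b/2)"
    and d: "z1 - z2 \<in> rect_lattice b"
  shows "z1 = z2"
proof -
  obtain m n :: int where mn: "Re z1 - Re z2 = of_int m" "Im z1 - Im z2 = of_int n * b"
    using d by (auto simp: rect_lattice_def complex_eq_iff)
  have c: "\<bar>Re z1\<bar> \<le> 1/2" "\<bar>Re z2\<bar> \<le> 1/2" "\<bar>Im z1\<bar> \<le> b/2" "\<bar>Im z2\<bar> \<le> b/2"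
    using z half_open_rectangle_subset_cell[of "b/2"] b by (auto simp: cell_def)
  have "\<bar>real_of_int m\<bar> \<le> 1" using c mn(1) by linarith
  then have "\<bar>m\<bar> \<le> 1" by linarith
  have "\<bar>real_of_int n * b\<bar> \<le> b" unfolding mn(2)[symmetric] using c by linarith
  then have "\<bar>real_of_int n\<bar> * b \<le> 1 * b" using b by (simp add: abs_mult)
  then have "\<bar>real_of_int n\<bar> \<le> 1" using b by (rule mult_right_le_imp_le)
  then have "\<bar>n\<bar> \<le> 1" by linarith
  with \<open>\<bar>m\<bar> \<le> 1\<close> have "m = -1 \<or> m = 0 \<or> m = 1" "n = -1 \<or> n = 0 \<or> n = 1" by linarith+
  then have "m = 0 \<and> n = 0"
    using mn z b c by (elim disjE) (auto simp: half_open_rectangle_def)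
  then show ?thesis using mn by (simp add: complex_eq_iff)
qed

text \<open>This and the next lemma record which real parts survive on the two roofs: no shift by
  \<open>1/2\<close> to either side carries a value from the upper set into the lower one.\<close>

lemma half_open_hexagon_top:
  assumes s: "0 < s" "s / 2 < h" and z: "z \<in> half_open_hexagon h s" and top: "Im z = h - s * \<bar>Re z\<bar>"
  shows "0 \<le> Re z \<and> Re z \<le> 1/4 \<or> Re z \<le> -1/4"
proof -
  from half_open_hexagon_linear[OF s(1) z] obtain a t where a: "a = s * \<bar>Re z\<bar>"
    and *: "0 \<le> a" "a \<le> s / 2" "0 \<le> Re z \<longrightarrow> a = t"
    "Re z \<le> 0 \<longrightarrow> a = - t" "Re z = 1/2 \<or> Re z = -1/2 \<longrightarrow> a = s / 2" "-1/2 \<le> Re z" "Re z \<le> 1/2"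
    "-1/2 < Re z \<and> Re z < 1/2 \<and> \<bar>Im z\<bar> + a < h \<or> Im z = h - t \<and> 0 \<le> Re z \<and> Re z \<le> 1/4 \<or>
     Im z = h + t \<and> -1/2 \<le> Re z \<and> Re z \<le> -1/4 \<or> Re z = -1/2 \<and> -(h - s/2) < Im z \<and> Im z \<le> 0 \<or>
     -1/4 < Re z \<and> Re z < 0 \<and> Im z = -h - t \<or> 1/4 < Re z \<and> Re z < 1/2 \<and> Im z = -h + t \<or>
     Re z = 1/2 \<and> 0 < Im z \<and> Im z < h - s/2" by blast
  show ?thesis using s * top[folded a] by (cases "0 \<le> Im z"; cases "0 \<le> Re z"; simp; argo)
qed

lemma half_open_hexagon_bottom:
  assumes s: "0 < s" "s / 2 < h" and z: "z \<in> half_open_hexagon h s" and bot: "Im z = - (h - s * \<bar>Re z\<bar>)"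
  shows "-1/4 < Re z \<and> Re z < 0 \<or> 1/4 < Re z \<and> Re z < 1/2"
proof -
  from half_open_hexagon_linear[OF s(1) z] obtain a t where a: "a = s * \<bar>Re z\<bar>"
    and *: "0 \<le> a" "a \<le> s / 2" "0 \<le> Re z \<longrightarrow> a = t"
    "Re z \<le> 0 \<longrightarrow> a = - t" "Re z = 1/2 \<or> Re z = -1/2 \<longrightarrow> a = s / 2" "-1/2 \<le> Re z" "Re z \<le> 1/2"
    "-1/2 < Re z \<and> Re z < 1/2 \<and> \<bar>Im z\<bar> + a < h \<or> Im z = h - t \<and> 0 \<le> Re z \<and> Re z \<le> 1/4 \<or>
     Im z = h + t \<and> -1/2 \<le> Re z \<and> Re z \<le> -1/4 \<or> Re z = -1/2 \<and> -(h - s/2) < Im z \<and> Im z \<le> 0 \<or>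
     -1/4 < Re z \<and> Re z < 0 \<and> Im z = -h - t \<or> 1/4 < Re z \<and> Re z < 1/2 \<and> Im z = -h + t \<or>
     Re z = 1/2 \<and> 0 < Im z \<and> Im z < h - s/2" by blast
  show ?thesis using s * bot[folded a] by (cases "0 \<le> Im z"; cases "0 \<le> Re z"; simp; argo)
qed

lemma half_open_hexagon_sides:
  assumes s: "0 < s" "s / 2 < h" and z: "z \<in> half_open_hexagon h s"
  shows "Re z = 1/2 \<Longrightarrow> 0 < Im z \<and> Im z < h - s/2" "Re z = -1/2 \<Longrightarrow> Im z \<le> 0 \<or> Im z = h - s/2"
  using z s by (auto simp: half_open_hexagon_def)

text \<open>A height difference of one lattice row forces the absolute real parts to add up to at
  most \<open>1/2\<close>, while \<open>R\<close> demands at least \<open>1/2\<close>. Equality puts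
  one point on the upper roof and the other on the lower one, half a unit apart, where the kept
  parts do not match.\<close>

lemma half_open_hexagon_no_vertical_overlap:
  assumes s: "0 < s" "s / 2 < h"
    and z: "z1 \<in> half_open_hexagon h s" "z2 \<in> half_open_hexagon h s"
    and I: "Im z1 - Im z2 = 2 * h - s / 2" and R: "1/2 \<le> \<bar>Re z1 - Re z2\<bar>"
  shows False
proof -
  have "z1 \<in> cell h s" "z2 \<in> cell h s" using half_open_hexagon_subset_cell[OF s] z by auto
  then have c: "\<bar>Im z1\<bar> \<le> h - s * \<bar>Re z1\<bar>" "\<bar>Im z2\<bar> \<le> h - s * \<bar>Re z2\<bar>" by (auto simp: cell_def)
  then have "s * (\<bar>Re z1\<bar> + \<bar>Re z2\<bar>) \<le> s * (1/2)" using I by (simp add: distrib_left)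
  then have le: "\<bar>Re z1\<bar> + \<bar>Re z2\<bar> \<le> 1/2" using s by simp
  then have eq: "\<bar>Re z1\<bar> + \<bar>Re z2\<bar> = 1/2" using R by linarith
  then have "s * \<bar>Re z1\<bar> + s * \<bar>Re z2\<bar> = s / 2" by (metis distrib_left times_divide_eq_right mult.right_neutral)
  then have "Im z1 = h - s * \<bar>Re z1\<bar>" "Im z2 = - (h - s * \<bar>Re z2\<bar>)" using c I by linarith+
  then show False
    using half_open_hexagon_top[OF s z(1)] half_open_hexagon_bottom[OF s z(2)] eq R by argo
qed

lemma half_open_hexagon_unique:
  assumes s: "0 < s" "s / 2 < h"
    and z: "z1 \<in> half_open_hexagon h s" "z2 \<in> half_open_hexagon h s"
    and d: "z1 - z2 \<in> rhombic_lattice (2 * h - s / 2)"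
  shows "z1 = z2"
proof -
  obtain m n :: int where mn: "Re z1 - Re z2 = of_int m + of_int n / 2"
      "Im z1 - Im z2 = of_int n * (2 * h - s / 2)"
    using d by (auto simp: rhombic_lattice_def complex_eq_iff)
  have "z1 \<in> cell h s" "z2 \<in> cell h s" using half_open_hexagon_subset_cell[OF s] z by auto
  then have c: "\<bar>Re z1\<bar> \<le> 1/2" "\<bar>Re z2\<bar> \<le> 1/2"
      "\<bar>Im z1\<bar> + s * \<bar>Re z1\<bar> \<le> h" "\<bar>Im z2\<bar> + s * \<bar>Re z2\<bar> \<le> h" by (auto simp: cell_def)
  moreover have "0 \<le> s * \<bar>Re z1\<bar>" "0 \<le> s * \<bar>Re z2\<bar>" using s by auto
  ultimately have "\<bar>of_int n * (2 * h - s / 2)\<bar> \<le> 2 * h" unfolding mn(2)[symmetric] by linarith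
  \<comment> \<open>Strictness is \<open>s / 2 < h\<close>: two row distances exceed the height
    \<open>2 * h\<close> of the cell.\<close>
  then have "\<bar>real_of_int n\<bar> * (2 * h - s / 2) < 2 * (2 * h - s / 2)" using s by (simp add: abs_mult)
  then have "\<bar>real_of_int n\<bar> < 2" 
    by (rule mult_right_less_imp_less) (use s in simp)
  then have "\<bar>n\<bar> < 2" by linarith
  then consider "n = 0" | "n = 1" | "n = -1" by linarith
  then show ?thesis
  proof cases
    case 1
    have "\<bar>real_of_int m\<bar> \<le> 1" using c mn(1) 1 by simp
    then have "\<bar>m\<bar> \<le> 1" by linarith
    then consider "m = 0" | "m = 1" | "m = -1" by linarith
    then show ?thesis
    proof cases
      case m: 1
      then show ?thesis using mn 1 by (simp add: complex_eq_iff)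
    next
      case m: 2
      then have "Re z1 = 1/2" "Re z2 = -1/2" using mn(1) 1 c by auto
      then show ?thesis
        using half_open_hexagon_sides(1)[OF s z(1)] half_open_hexagon_sides(2)[OF s z(2)] mn(2) 1 by auto
    next
      case m: 3
      then have "Re z2 = 1/2" "Re z1 = -1/2" using mn(1) 1 c by auto
      then show ?thesis
        using half_open_hexagon_sides(1)[OF s z(2)] half_open_hexagon_sides(2)[OF s z(1)] mn(2) 1 by auto
    qed
  next
    case 2
    have "0 \<le> m \<or> m \<le> -1" by linarith
    then have "1/2 \<le> \<bar>real_of_int m + 1/2\<bar>" by (elim disjE) linarith+
    then show ?thesis
      using half_open_hexagon_no_vertical_overlap[OF s z] mn 2 by simp
  next
    case 3
    have "1 \<le> m \<or> m \<le> 0" by linarith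
    then have "1/2 \<le> \<bar>real_of_int m - 1/2\<bar>" by (elim disjE) linarith+
    moreover have "\<bar>Re z2 - Re z1\<bar> = \<bar>real_of_int m - 1/2\<bar>"
      using mn(1) 3 by (simp add: abs_minus_commute)
    moreover have "Im z2 - Im z1 = 2 * h - s / 2" using mn(2) 3 by simp
    ultimately show ?thesis
      using half_open_hexagon_no_vertical_overlap[OF s z(2) z(1)] by simp
  qed
qed

lemma rhombic_lattice_add:
  assumes "x \<in> rhombic_lattice b" "y \<in> rhombic_lattice b"
  shows "x + y \<in> rhombic_lattice b"
proof -
  obtain m n m' n' :: int where "x = Complex (of_int m + of_int n / 2) (of_int n * b)"
    "y = Complex (of_int m' + of_int n' / 2) (of_int n' * b)"
    using assms by (auto simp: rhombic_lattice_def)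
  then have "x + y = Complex (of_int (m + m') + of_int (n + n') / 2) (of_int (n + n') * b)"
    by (simp add: complex_eq_iff algebra_simps add_divide_distrib)
  then show ?thesis unfolding rhombic_lattice_def by blast
qed

text \<open>Rounding reaches a rectangle of width 1 and height \<open>b\<close>. A point in a corner
  cut off by the roof is moved by the nearest lattice point of the form (1/2, b) up to signs; since
  \<open>b + s / 2 = 2 * h\<close>, violating the roof condition before the move implies it
  afterwards.\<close>

lemma cell_covers_rhombic:
  assumes s: "0 < s" "s / 2 < h"
  shows "\<exists>y \<in> rhombic_lattice (2 * h - s / 2). z - y \<in> cell h s"
proof -
  define b where "b = 2 * h - s / 2"
  have b: "0 < b" using s by (simp add: b_def)
  define n where "n = \<lceil>Im z / b - 1/2\<rceil>"
  define m where "m = \<lfloor>Re z - of_int n / 2 + 1/2\<rfloor>"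
  define X where "X = Re z - (of_int m + of_int n / 2)"
  define Y where "Y = Im z - of_int n * b"
  have X: "\<bar>X\<bar> \<le> 1/2" unfolding X_def m_def by linarith
  have "Im z / b - 1/2 \<le> of_int n" "of_int n < Im z / b + 1/2" unfolding n_def by linarith+
  then have "Y \<le> b/2" "-(b/2) \<le> Y" unfolding Y_def using b by (auto simp: field_simps)
  then have Y: "\<bar>Y\<bar> \<le> b/2" by linarith
  have mem: "Complex (of_int m' + of_int n' / 2) (of_int n' * b) \<in> rhombic_lattice b" for m' n'
    by (auto simp: rhombic_lattice_def)
  have z: "z - Complex (of_int m + of_int n / 2) (of_int n * b) = Complex X Y"
    by (simp add: X_def Y_def complex_eq_iff)
  show ?thesis
  proof (cases "\<bar>Y\<bar> + s * \<bar>X\<bar> \<le> h")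
    case True
    then have "Complex X Y \<in> cell h s" using X by (simp add: cell_def)
    then show ?thesis using mem z unfolding b_def by metis
  next
    case False
    define e f :: int where "e = (if 0 \<le> X then 1 else -1)" and "f = (if 0 \<le> Y then 1 else -1)"
    have d: "Complex (of_int e / 2) (of_int f * b) \<in> rhombic_lattice b"
      using mem[of 0 1] mem[of 0 "-1"] mem[of 1 "-1"] mem[of "-1" 1] by (auto simp: e_def f_def)
    have RX: "\<bar>X - of_int e / 2\<bar> = 1/2 - \<bar>X\<bar>" and IY: "\<bar>Y - of_int f * b\<bar> = b - \<bar>Y\<bar>"
      using X Y b by (auto simp: e_def f_def)
    have "b - \<bar>Y\<bar> + s * (1/2 - \<bar>X\<bar>) \<le> h"
      using False by (simp add: b_def algebra_simps)
    then have "Complex X Y - Complex (of_int e / 2) (of_int f * b) \<in> cell h s"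
      using RX IY by (simp add: cell_def)
    then have "z - (Complex (of_int m + of_int n / 2) (of_int n * b)
        + Complex (of_int e / 2) (of_int f * b)) \<in> cell h s"
      unfolding z[symmetric] by (simp only: diff_diff_eq)
    then show ?thesis using rhombic_lattice_add[OF mem d] unfolding b_def by blast
  qed
qed

text \<open>Each dropped half edge is carried by one lattice vector to the kept half of the opposite
  edge. Dropped vertices go to the upper apex or to the upper left vertex, according to their
  class.\<close>

lemma half_open_hexagon_covers:
  assumes s: "0 < s" "s / 2 < h"
  shows "\<exists>y \<in> rhombic_lattice (2 * h - s / 2). z - y \<in> half_open_hexagon h s"
proof -
  define b where "b = 2 * h - s / 2"
  obtain y where y: "y \<in> rhombic_lattice b" "z - y \<in> cell h s"
    using cell_covers_rhombic[OF s] unfolding b_def by blast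
  define X Y where "X = Re (z - y)" and "Y = Im (z - y)"
  have zy: "z - y = Complex X Y" by (simp add: X_def Y_def complex_eq_iff)
  have c: "\<bar>X\<bar> \<le> 1/2" "\<bar>Y\<bar> + s * \<bar>X\<bar> \<le> h"
    using y by (simp_all add: zy cell_def)
  have mem: "Complex (of_int m' + of_int n' / 2) (of_int n' * b) \<in> rhombic_lattice b" for m' n'
    by (auto simp: rhombic_lattice_def)
  have "\<exists>d \<in> rhombic_lattice b. Complex X Y - d \<in> half_open_hexagon h s"
  proof -
    have move: ?thesis if "Complex (X - (of_int m + of_int n / 2)) (Y - of_int n * b) \<in> half_open_hexagon h s" for m n
      using that mem[of m n] by (metis complex_diff)
    have inner: ?thesis if "Complex X Y \<in> half_open_hexagon h s"
      using that move[of 0 0] by simp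
    consider "\<bar>X\<bar> < 1/2" "\<bar>Y\<bar> + s * \<bar>X\<bar> < h" | "X = 1/2" | "X = -1/2"
      | "\<bar>X\<bar> < 1/2" "Y = h - s * \<bar>X\<bar>" | "\<bar>X\<bar> < 1/2" "Y = - (h - s * \<bar>X\<bar>)"
      using c by linarith
    then show ?thesis
    proof cases
      case 1
      then show ?thesis by (intro inner half_open_hexagonI(1)) simp_all
    next
      case 2
      have Y: "\<bar>Y\<bar> \<le> h - s/2" using c(2) 2 by simp
      consider "Y = -(h - s/2)" | "-(h - s/2) < Y" "Y \<le> 0" | "0 < Y" "Y < h - s/2" | "Y = h - s/2"
        using Y by linarith
      then show ?thesis
      proof cases
        case 1
        then show ?thesis using 2 by (intro move[of 1 "-1"] half_open_hexagonI(2)) (simp_all add: b_def)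
      next
        case Y: 2
        then show ?thesis using 2 by (intro move[of 1 0] half_open_hexagonI(4)) simp_all
      next
        case 3
        then show ?thesis using 2 by (intro inner half_open_hexagonI(7)) simp_all
      next
        case 4
        then show ?thesis by (intro move[of 1 0] half_open_hexagonI(3)) (simp_all add: 2)
      qed
    next
      case 3
      have Y: "\<bar>Y\<bar> \<le> h - s/2" using c(2) 3 by simp
      consider "Y = -(h - s/2)" | "-(h - s/2) < Y" "Y \<le> 0" | "0 < Y" "Y < h - s/2" | "Y = h - s/2"
        using Y by linarith
      then show ?thesis
      proof cases
        case 1
        then show ?thesis using 3 by (intro move[of 0 "-1"] half_open_hexagonI(2)) (simp_all add: b_def)
      next
        case 2
        then show ?thesis using 3 by (intro inner half_open_hexagonI(4)) simp_all
      next
        case Y: 3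
        then show ?thesis using 3 by (intro move[of "-1" 0] half_open_hexagonI(7)) simp_all
      next
        case 4
        then show ?thesis using 3 by (intro inner half_open_hexagonI(3)) simp_all
      qed
    next
      case 4
      consider "-1/2 \<le> X" "X \<le> -1/4" | "-1/4 < X" "X < 0" | "0 \<le> X" "X \<le> 1/4" | "1/4 < X" "X < 1/2"
        using 4 by linarith
      then show ?thesis
      proof cases
        case 1
        then show ?thesis using 4 by (intro inner half_open_hexagonI(3)) simp_all
      next
        case 2
        then show ?thesis using 4
          by (intro move[of "-1" 1] half_open_hexagonI(6)) (simp_all add: b_def algebra_simps)
      next
        case 3
        then show ?thesis using 4 by (intro inner half_open_hexagonI(2)) simp_all
      next
        case X: 4
        then show ?thesis using 4
          by (intro move[of 0 1] half_open_hexagonI(5)) (simp_all add: b_def algebra_simps)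
      qed
    next
      case 5
      consider "-1/2 \<le> X" "X \<le> -1/4" | "-1/4 < X" "X < 0" | "0 \<le> X" "X \<le> 1/4" | "1/4 < X" "X < 1/2"
        using 5 by linarith
      then show ?thesis
      proof cases
        case 1
        then show ?thesis using 5
          by (intro move[of 0 "-1"] half_open_hexagonI(2)) (simp_all add: b_def algebra_simps)
      next
        case 2
        then show ?thesis using 5 by (intro inner half_open_hexagonI(5)) simp_all
      next
        case 3
        then show ?thesis using 5
          by (intro move[of 1 "-1"] half_open_hexagonI(3)) (simp_all add: b_def algebra_simps)
      next
        case 4
        then show ?thesis using 5 by (intro inner half_open_hexagonI(6)) simp_all
      qed
    qed
  qed
  then obtain d where d: "d \<in> rhombic_lattice b" "z - y - d \<in> half_open_hexagon h s" unfolding zy by blast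
  then have "z - (y + d) \<in> half_open_hexagon h s" by (simp only: diff_diff_eq)
  then show ?thesis using rhombic_lattice_add[OF y(1) d(1)] unfolding b_def by blast
qed

text \<open>On the roof the squared modulus \<open>x\<^sup>2 + (h - s * x)\<^sup>2\<close> is convex
  in \<open>x\<close>, and the last assumption makes it equal to \<open>h\<^sup>2\<close> both at 0
  and at \<open>1/2\<close>.\<close>

lemma cell_norm_bound:
  assumes "z \<in> cell h s" "0 \<le> s" "0 \<le> h" "1 + s\<^sup>2 = 4 * h * s"
  shows "(cmod z)\<^sup>2 \<le> h\<^sup>2"
proof -
  define x where "x = \<bar>Re z\<bar>"
  have x: "0 \<le> x" "x \<le> 1/2" "\<bar>Im z\<bar> \<le> h - s * x" using assms by (auto simp: cell_def x_def)
  have "\<bar>Im z\<bar>\<^sup>2 \<le> (h - s * x)\<^sup>2" using x by (intro power_mono) auto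
  then have "(cmod z)\<^sup>2 \<le> x\<^sup>2 + (h - s * x)\<^sup>2" unfolding cmod_power2 by (simp add: x_def)
  also have "\<dots> = h\<^sup>2 - 2 * h * s * x + (1 + s\<^sup>2) * x\<^sup>2" by (simp add: power2_eq_square algebra_simps)
  also have "\<dots> = h\<^sup>2 - 2 * h * s * (x * (1 - 2 * x))" unfolding assms(4) by (simp add: power2_eq_square algebra_simps)
  also have "\<dots> \<le> h\<^sup>2" using x assms by simp
  finally show ?thesis .
qed

section \<open>The order generated by an imaginary quadratic base\<close>

locale imaginary_quadratic =
  fixes p q :: int and \<tau> :: complex
  assumes disc: "4 * q - p ^ 2 > 0"
    and root: "\<tau> ^ 2 - of_int p * \<tau> + of_int q = 0"
    and norm_base: "cmod \<tau> > 1"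
begin

lemma base_square: "\<tau>\<^sup>2 = of_int p * \<tau> - of_int q"
  using root by (simp add: algebra_simps)

lemma Im_base_nonzero: "Im \<tau> \<noteq> 0"
proof
  assume "Im \<tau> = 0"
  then have "(Re \<tau>)\<^sup>2 - of_int p * Re \<tau> + of_int q = 0"
    using arg_cong[OF root, of Re] by (simp add: power2_eq_square)
  then have "(2 * Re \<tau> - of_int p)\<^sup>2 = of_int (p\<^sup>2 - 4 * q)"
    by (simp add: power2_eq_square algebra_simps)
  moreover have "real_of_int (p\<^sup>2 - 4 * q) < 0" using disc by (simp only: of_int_less_0_iff)
  ultimately show False by (metis not_less zero_le_power2)
qed

lemma Re_base: "Re \<tau> = of_int p / 2"
proof -
  have "Im \<tau> * (2 * Re \<tau> - of_int p) = 0"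
    using arg_cong[OF root, of Im] by (simp add: power2_eq_square algebra_simps)
  then show ?thesis using Im_base_nonzero by simp
qed

lemma Im_base_square: "(Im \<tau>)\<^sup>2 = of_int q - (of_int p)\<^sup>2 / 4"
proof -
  have "(Re \<tau>)\<^sup>2 - (Im \<tau>)\<^sup>2 - of_int p * Re \<tau> + of_int q = 0"
    using arg_cong[OF root, of Re] by (simp add: power2_eq_square)
  then show ?thesis by (simp add: Re_base power2_eq_square field_simps)
qed

lemma norm_base_square: "(cmod \<tau>)\<^sup>2 = of_int q"
  unfolding cmod_power2 Im_base_square by (simp add: Re_base power_divide)

lemma q_ge_2: "2 \<le> q"
proof -
  have "1 < (cmod \<tau>)\<^sup>2" using norm_base by (simp add: one_less_power)
  then show ?thesis unfolding norm_base_square by simp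
qed

lemma base_nonzero: "\<tau> \<noteq> 0"
  using norm_base by auto

lemma zring_eq: "zring \<tau> = {of_int m + of_int n * \<tau> | m n. True}"
proof
  have "\<exists>m n. poly (map_poly of_int f) \<tau> = of_int m + of_int n * \<tau>" for f
  proof (induction f)
    case 0
    show ?case by (intro exI[of _ 0]) simp
  next
    case (pCons a f)
    then obtain m n where mn: "poly (map_poly of_int f) \<tau> = of_int m + of_int n * \<tau>" by blast
    have "poly (map_poly of_int (pCons a f)) \<tau> = of_int a + \<tau> * (of_int m + of_int n * \<tau>)"
      by (simp add: map_poly_pCons mn)
    also have "\<dots> = of_int a + of_int m * \<tau> + of_int n * \<tau>\<^sup>2"
      by (simp add: power2_eq_square algebra_simps)
    also have "\<dots> = of_int (a - n * q) + of_int (m + n * p) * \<tau>"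
      unfolding base_square by (simp add: algebra_simps)
    finally show ?case by blast
  qed
  then show "zring \<tau> \<subseteq> {of_int m + of_int n * \<tau> | m n. True}" unfolding zring_def by blast
  show "{of_int m + of_int n * \<tau> | m n. True} \<subseteq> zring \<tau>"
  proof safe
    fix m n
    have "of_int m + of_int n * \<tau> = poly (map_poly of_int [:m, n:]) \<tau>"
      by (simp add: map_poly_pCons)
    then show "of_int m + of_int n * \<tau> \<in> zring \<tau>" unfolding zring_def by blast
  qed
qed

lemma zringE:
  assumes "x \<in> zring \<tau>"
  obtains m n where "x = of_int m + of_int n * \<tau>"
  using assms unfolding zring_eq by blast

lemma zringI: "of_int m + of_int n * \<tau> \<in> zring \<tau>"
  unfolding zring_eq by blast

lemma zring_of_int: "of_int m \<in> zring \<tau>"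
  using zringI[of m 0] by simp

lemma zring_base: "\<tau> \<in> zring \<tau>"
  using zringI[of 0 1] by simp

lemma zring_diff: "x \<in> zring \<tau> \<Longrightarrow> y \<in> zring \<tau> \<Longrightarrow> x - y \<in> zring \<tau>"
  using zringI[of "m - m'" "n - n'" for m m' n n'] by (elim zringE) (simp add: algebra_simps)

lemma zring_uminus: "x \<in> zring \<tau> \<Longrightarrow> - x \<in> zring \<tau>"
  using zring_diff[of 0 x] zring_of_int[of 0] by simp

lemma zring_add: "x \<in> zring \<tau> \<Longrightarrow> y \<in> zring \<tau> \<Longrightarrow> x + y \<in> zring \<tau>"
  using zring_diff[of x "- y"] zring_uminus[of y] by simp

lemma zring_mult:
  assumes "x \<in> zring \<tau>" "y \<in> zring \<tau>"
  shows "x * y \<in> zring \<tau>"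
proof -
  obtain m n m' n' where x: "x = of_int m + of_int n * \<tau>" and y: "y = of_int m' + of_int n' * \<tau>"
    using assms by (elim zringE)
  have "x * y = of_int (m * m') + of_int (m * n' + n * m') * \<tau> + of_int (n * n') * \<tau>\<^sup>2"
    unfolding x y by (simp add: power2_eq_square algebra_simps)
  also have "\<dots> = of_int (m * m' - n * n' * q) + of_int (m * n' + n * m' + n * n' * p) * \<tau>"
    unfolding base_square by (simp add: algebra_simps)
  finally show ?thesis by (simp only: zringI)
qed

lemma zring_power: "x \<in> zring \<tau> \<Longrightarrow> x ^ k \<in> zring \<tau>"
  using zring_of_int[of 1] by (induction k) (auto simp: zring_mult)

lemma zring_norm_form:
  "(cmod (of_int m + of_int n * \<tau>))\<^sup>2 = of_int (m\<^sup>2 + p * m * n + q * n\<^sup>2)"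
proof -
  have "(cmod (of_int m + of_int n * \<tau>))\<^sup>2 = (of_int m + of_int n * (of_int p / 2))\<^sup>2 + (of_int n)\<^sup>2 * (Im \<tau>)\<^sup>2"
    unfolding cmod_power2 by (simp add: Re_base power_mult_distrib)
  then show ?thesis unfolding Im_base_square by (simp add: power2_eq_square field_simps)
qed

text \<open>Integrality of the squared modulus keeps nonzero elements away from 0 and supplies the
  measure for the descent.\<close>

lemma zring_norm_nat:
  assumes "x \<in> zring \<tau>"
  obtains N :: nat where "(cmod x)\<^sup>2 = of_nat N"
proof -
  obtain k :: int where k: "(cmod x)\<^sup>2 = of_int k" using assms zring_norm_form by (metis zringE)
  then have "0 \<le> k" by (metis of_int_0_le_iff zero_le_power2)
  then show thesis using that[of "nat k"] k by simp
qed

lemma zring_norm_ge_1: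
  assumes "x \<in> zring \<tau>" "x \<noteq> 0"
  shows "1 \<le> cmod x"
proof -
  obtain N :: nat where N: "(cmod x)\<^sup>2 = of_nat N" using zring_norm_nat[OF assms(1)] .
  then have "N \<noteq> 0" using assms(2) by (metis norm_eq_zero of_nat_0 zero_eq_power2)
  then have "1\<^sup>2 \<le> (cmod x)\<^sup>2" unfolding N by simp
  then show ?thesis by (rule power2_le_imp_le) simp
qed

lemma finite_zring_ball: "finite {x \<in> zring \<tau>. cmod x \<le> c}"
proof -
  define K where "K = c / \<bar>Im \<tau>\<bar>"
  \<comment> \<open>\<open>K\<close> bounds the coefficient of \<open>\<tau>\<close> through the
    imaginary part, and \<open>c + K * cmod \<tau>\<close> then bounds the other coefficient; the
    sum serves for both.\<close>
  define B where "B = \<lceil>c + K * cmod \<tau> + K\<rceil>"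
  have "{x \<in> zring \<tau>. cmod x \<le> c} \<subseteq> (\<lambda>(m, n). of_int m + of_int n * \<tau>) ` ({-B..B} \<times> {-B..B})"
  proof
    fix x assume x: "x \<in> {x \<in> zring \<tau>. cmod x \<le> c}"
    then obtain m n where mn: "x = of_int m + of_int n * \<tau>" by (auto elim: zringE)
    have c: "0 \<le> c" "cmod x \<le> c" using x order_trans[OF norm_ge_zero[of x], of c] by auto
    have "\<bar>real_of_int n\<bar> * \<bar>Im \<tau>\<bar> \<le> c"
      using abs_Im_le_cmod[of x] c unfolding mn by (simp add: abs_mult)
    then have n: "\<bar>real_of_int n\<bar> \<le> K" using Im_base_nonzero by (simp add: K_def field_simps)
    have "\<bar>real_of_int m\<bar> = cmod (x - of_int n * \<tau>)" by (simp add: mn)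
    also have "\<dots> \<le> c + \<bar>real_of_int n\<bar> * cmod \<tau>"
      using norm_triangle_ineq4[of x "of_int n * \<tau>"] c by (simp add: norm_mult)
    also have "\<dots> \<le> c + K * cmod \<tau>" using n by (simp add: mult_right_mono)
    finally have m: "\<bar>real_of_int m\<bar> \<le> c + K * cmod \<tau>" .
    have "0 \<le> K" using n by linarith
    then have "\<bar>real_of_int m\<bar> \<le> c + K * cmod \<tau> + K" "\<bar>real_of_int n\<bar> \<le> c + K * cmod \<tau> + K"
      using m n c by auto
    then have "m \<in> {-B..B}" "n \<in> {-B..B}" unfolding B_def atLeastAtMost_iff by linarith+
    then show "x \<in> (\<lambda>(m, n). of_int m + of_int n * \<tau>) ` ({-B..B} \<times> {-B..B})"
      unfolding mn by auto
  qed
  then show ?thesis by (rule finite_subset) simp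
qed

lemma zring_even:
  assumes "even p"
  shows "zring \<tau> = rect_lattice \<bar>Im \<tau>\<bar>"
proof -
  obtain a where a: "p = 2 * a" using assms by blast
  \<comment> \<open>The sign of \<open>Im \<tau>\<close> turns the second generator upwards for
    either choice of the root.\<close>
  define e :: int where "e = (if 0 \<le> Im \<tau> then 1 else -1)"
  have e: "e * e = 1" "Im \<tau> = of_int e * \<bar>Im \<tau>\<bar>" by (auto simp: e_def)
  have *: "of_int m + of_int n * \<tau> = Complex (of_int (m + n * a)) (of_int (n * e) * \<bar>Im \<tau>\<bar>)" for m n
    using e(2) by (simp add: complex_eq_iff Re_base a)
  show ?thesis
  proof
    show "zring \<tau> \<subseteq> rect_lattice \<bar>Im \<tau>\<bar>"
      unfolding zring_eq rect_lattice_def * by blast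
    show "rect_lattice \<bar>Im \<tau>\<bar> \<subseteq> zring \<tau>"
    proof
      fix x assume "x \<in> rect_lattice \<bar>Im \<tau>\<bar>"
      then obtain m n where "x = Complex (of_int m) (of_int n * \<bar>Im \<tau>\<bar>)" by (auto simp: rect_lattice_def)
      then have "x = of_int (m - n * e * a) + of_int (n * e) * \<tau>"
        unfolding * using e(1) by (simp add: mult.assoc)
      then show "x \<in> zring \<tau>" by (simp only: zringI)
    qed
  qed
qed

lemma zring_odd:
  assumes "odd p"
  shows "zring \<tau> = rhombic_lattice \<bar>Im \<tau>\<bar>"
proof -
  obtain a where a: "p = 2 * a + 1" using assms oddE by blast
  have *: "of_int m + of_int n * \<tau> = Complex (of_int (m + n * a) + of_int n / 2) (of_int n * Im \<tau>)" for m n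
    by (simp add: complex_eq_iff Re_base a field_simps)
  show ?thesis
  proof (cases "0 \<le> Im \<tau>")
    case True
    then have I: "\<bar>Im \<tau>\<bar> = Im \<tau>" by simp
    show ?thesis
    proof
      show "zring \<tau> \<subseteq> rhombic_lattice \<bar>Im \<tau>\<bar>"
        unfolding zring_eq rhombic_lattice_def * I by blast
      show "rhombic_lattice \<bar>Im \<tau>\<bar> \<subseteq> zring \<tau>"
      proof
        fix x assume "x \<in> rhombic_lattice \<bar>Im \<tau>\<bar>"
        then obtain m n where "x = Complex (of_int m + of_int n / 2) (of_int n * Im \<tau>)"
          unfolding rhombic_lattice_def I by blast
        then have "x = of_int (m - n * a) + of_int n * \<tau>" unfolding * by simp
        then show "x \<in> zring \<tau>" by (simp only: zringI)
      qed
    qed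
  next
    case False
    then have I: "\<bar>Im \<tau>\<bar> = - Im \<tau>" by simp
    \<comment> \<open>The rhombic lattice is symmetric under conjugation: \<open>n\<close> changes
      sign and \<open>m\<close> absorbs the change in the real part.\<close>
    have **: "Complex (of_int (m + n) + of_int (- n) / 2) (of_int (- n) * - Im \<tau>) =
        Complex (of_int m + of_int n / 2) (of_int n * Im \<tau>)" for m n
      by (simp add: complex_eq_iff)
    show ?thesis
    proof
      show "zring \<tau> \<subseteq> rhombic_lattice \<bar>Im \<tau>\<bar>"
        unfolding zring_eq rhombic_lattice_def * I **[symmetric] by blast
      show "rhombic_lattice \<bar>Im \<tau>\<bar> \<subseteq> zring \<tau>"
      proof
        fix x assume "x \<in> rhombic_lattice \<bar>Im \<tau>\<bar>"
        then obtain m n where "x = Complex (of_int m + of_int n / 2) (of_int n * - Im \<tau>)"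
          unfolding rhombic_lattice_def I by blast
        then have "x = of_int (m + n + n * a) + of_int (- n) * \<tau>"
          unfolding * by (simp add: complex_eq_iff)
        then show "x \<in> zring \<tau>" using zringI by metis
      qed
    qed
  qed
qed

section \<open>Shape and size of the restricted Voronoi cell\<close>

lemma restricted_voronoi_even:
  assumes "even p"
  shows "restricted_voronoi \<tau> = half_open_rectangle (\<bar>Im \<tau>\<bar> / 2)"
  using Im_base_nonzero
  by (intro restricted_voronoi_rectangle voronoi_rectangle zring_even assms) auto

text \<open>For odd \<open>p\<close> the positive number \<open>4 * q - p\<^sup>2\<close> is 3
  modulo 4, hence at least 3.\<close>

lemma Im_base_square_odd:
  assumes "odd p"
  shows "3/4 \<le> \<bar>Im \<tau>\<bar>\<^sup>2"
proof -
  obtain a where a: "p = 2 * a + 1" using assms oddE by blast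
  have "4 * q - p\<^sup>2 = 4 * (q - a * a - a) - 1" by (simp add: a power2_eq_square algebra_simps)
  then have "3 \<le> 4 * q - p\<^sup>2" using disc by presburger
  then have "3 \<le> real_of_int (4 * q - p\<^sup>2)" by linarith
  then show ?thesis by (simp add: Im_base_square)
qed

text \<open>The last claim identifies \<open>b\<close> with the row distance
  \<open>2 * h - s / 2\<close> in which the hexagon tiling is phrased.\<close>

lemma restricted_voronoi_odd:
  assumes "odd p"
  defines "b \<equiv> \<bar>Im \<tau>\<bar>"
  shows "restricted_voronoi \<tau> = half_open_hexagon (b/2 + 1/(8*b)) (1/(2*b))"
    and "1/(2*b) / 2 < b/2 + 1/(8*b)" and "b = 2 * (b/2 + 1/(8*b)) - 1/(2*b) / 2"
proof -
  have b: "0 < b" "3/4 \<le> b\<^sup>2" using Im_base_nonzero Im_base_square_odd assms by auto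
  then show lt: "1/(2*b) / 2 < b/2 + 1/(8*b)" by (simp add: field_simps power2_eq_square)
  show "b = 2 * (b/2 + 1/(8*b)) - 1/(2*b) / 2" using b by (simp add: field_simps)
  have "(b/2 + 1/(8*b))\<^sup>2 = 1/4 + (b/2 + 1/(8*b) - 1/(2*b) / 2)\<^sup>2"
    using b by (simp add: power2_eq_square field_simps)
  moreover have "voronoi \<tau> = cell (b/2 + 1/(8*b)) (1/(2*b))"
    using voronoi_hexagon[of \<tau> b] zring_odd assms b by simp
  ultimately show "restricted_voronoi \<tau> = half_open_hexagon (b/2 + 1/(8*b)) (1/(2*b))"
    using b lt by (intro restricted_voronoi_hexagon) auto
qed

lemma restricted_voronoi_tiles: "\<exists>!y. y \<in> zring \<tau> \<and> z - y \<in> restricted_voronoi \<tau>"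
proof (rule ex_ex1I)
  let ?b = "\<bar>Im \<tau>\<bar>"
  have b: "0 < ?b" using Im_base_nonzero by simp
  show "\<exists>y. y \<in> zring \<tau> \<and> z - y \<in> restricted_voronoi \<tau>"
  proof (cases "even p")
    case True
    then show ?thesis using half_open_rectangle_covers[OF b]
      by (auto simp: zring_even restricted_voronoi_even)
  next
    case False
    then show ?thesis
      using half_open_hexagon_covers[of "1/(2*?b)" "?b/2 + 1/(8*?b)" z] restricted_voronoi_odd(2,3) b
      by (auto simp: zring_odd restricted_voronoi_odd(1))
  qed
  fix y1 y2
  assume y: "y1 \<in> zring \<tau> \<and> z - y1 \<in> restricted_voronoi \<tau>" "y2 \<in> zring \<tau> \<and> z - y2 \<in> restricted_voronoi \<tau>"
  then have d: "(z - y1) - (z - y2) \<in> zring \<tau>" using zring_diff[of y2 y1] by simp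
  have "z - y1 = z - y2"
  proof (cases "even p")
    case True
    then show ?thesis using half_open_rectangle_unique[OF b] y d
      by (metis zring_even restricted_voronoi_even)
  next
    case False
    then show ?thesis
      using half_open_hexagon_unique[of "1/(2*?b)" "?b/2 + 1/(8*?b)" "z - y1" "z - y2"]
        restricted_voronoi_odd(2,3) b y d
      by (auto simp: zring_odd restricted_voronoi_odd(1))
  qed
  then show "y1 = y2" by simp
qed

text \<open>The squared circumradius is \<open>(1 + b\<^sup>2) / 4\<close> for the rectangle and
  \<open>b\<^sup>2/4 + 1/8 + 1 / (64 * b\<^sup>2)\<close> for the hexagon, which is smaller because
  \<open>3/4 \<le> b\<^sup>2\<close>. Finally \<open>b\<^sup>2 \<le> q\<close> gives one constant
  for all \<open>p\<close>.\<close>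

lemma restricted_voronoi_norm:
  assumes z: "z \<in> restricted_voronoi \<tau>"
  shows "cmod z \<le> sqrt (1 + of_int q) / 2"
proof -
  define b where "b = \<bar>Im \<tau>\<bar>"
  have b: "0 < b" using Im_base_nonzero by (simp add: b_def)
  have bq: "b\<^sup>2 \<le> of_int q" by (simp add: b_def Im_base_square)
  have "4 * (cmod z)\<^sup>2 \<le> 1 + b\<^sup>2"
  proof (cases "even p")
    case True
    then have "z \<in> cell (b/2) 0"
      using z half_open_rectangle_subset_cell[of "b/2"] b by (auto simp: restricted_voronoi_even b_def)
    then have "\<bar>Re z\<bar> \<le> 1/2" "\<bar>Im z\<bar> \<le> b/2" by (auto simp: cell_def)
    then have "\<bar>Re z\<bar>\<^sup>2 \<le> (1/2)\<^sup>2" "\<bar>Im z\<bar>\<^sup>2 \<le> (b/2)\<^sup>2" by (intro power_mono; simp)+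
    then show ?thesis unfolding cmod_power2 by (simp add: power_divide)
  next
    case False
    define h s where "h = b/2 + 1/(8*b)" and "s = 1/(2*b)"
    have b2: "3/4 \<le> b\<^sup>2" using Im_base_square_odd[OF False] by (simp add: b_def)
    have "z \<in> cell h s"
      using z half_open_hexagon_subset_cell[of s h] restricted_voronoi_odd[OF False] b
      by (auto simp: h_def s_def b_def)
    moreover have "1 + s\<^sup>2 = 4 * h * s" using b by (simp add: h_def s_def power2_eq_square field_simps)
    ultimately have "(cmod z)\<^sup>2 \<le> h\<^sup>2" using b by (intro cell_norm_bound) (auto simp: h_def s_def)
    also have "h\<^sup>2 = b\<^sup>2/4 + 1/8 + 1 / (64 * b\<^sup>2)" using b by (simp add: h_def power2_eq_square field_simps)
    also have "1 / (64 * b\<^sup>2) \<le> 1 / 48" using b2 b by (simp add: field_simps)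
    finally show ?thesis by simp
  qed
  then have "(2 * cmod z)\<^sup>2 \<le> 1 + of_int q" using bq by (simp add: power_mult_distrib)
  then show ?thesis using real_le_rsqrt by force
qed

text \<open>Nonzero lattice elements have modulus at least 1, so the disc of radius
  \<open>1/2\<close> is free of boundary questions. It makes short elements not divisible by
  \<open>\<tau>\<close> their own digits.\<close>

lemma ball_subset_restricted_voronoi:
  assumes "cmod z < 1/2"
  shows "z \<in> restricted_voronoi \<tau>"
proof -
  have "ball 0 (1/2) \<subseteq> voronoi \<tau>"
  proof
    fix x :: complex assume "x \<in> ball 0 (1/2)"
    then have x: "cmod x < 1/2" by simp
    have "cmod x \<le> cmod (x - y)" if "y \<in> zring \<tau>" for y
    proof (cases "y = 0")
      case False
      then have "1 \<le> cmod y" using that zring_norm_ge_1 by blast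
      moreover have "cmod y \<le> cmod x + cmod (x - y)"
        by (metis norm_minus_commute norm_triangle_sub)
      ultimately show ?thesis using x by simp
    qed simp
    then show "x \<in> voronoi \<tau>" by (simp add: voronoi_def)
  qed
  then have "ball 0 (1/2) \<subseteq> interior (voronoi \<tau>)" by (rule interior_maximal) simp
  then show ?thesis using assms by (auto simp: restricted_voronoi_def)
qed

end

section \<open>Expansions as limits of finite expansions\<close>

text \<open>The last argument is only an upper bound for the number of positions, so
  \<open>zero\<close> allows every \<open>n\<close>. The rule \<open>digit\<close> uses up
  \<open>w\<close> positions at once, which builds the \<open>w - 1\<close> zeros into the
  recursion.\<close>

inductive naf_value :: "complex \<Rightarrow> nat \<Rightarrow> complex set \<Rightarrow> complex \<Rightarrow> nat \<Rightarrow> bool"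
  for \<tau> :: complex and w :: nat and D :: "complex set" where
  zero: "naf_value \<tau> w D 0 n"
| shift: "naf_value \<tau> w D y n \<Longrightarrow> naf_value \<tau> w D (\<tau> * y) (Suc n)"
| digit: "d \<in> D \<Longrightarrow> naf_value \<tau> w D y n \<Longrightarrow> naf_value \<tau> w D (d + \<tau> ^ w * y) (n + w)"

lemma naf_value_mono: "naf_value \<tau> w D x m \<Longrightarrow> m \<le> n \<Longrightarrow> naf_value \<tau> w D x n"
proof (induction arbitrary: n rule: naf_value.induct)
  case (shift y m)
  then obtain k where "n = Suc k" "m \<le> k"
    by (metis Suc_le_D Suc_le_mono)
  then show ?case using shift.IH naf_value.shift by blast
next
  case (digit d y m)
  then obtain k where "n = k + w" "m \<le> k"
    by (metis add.commute add_leE le_Suc_ex nat_add_left_cancel_le)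
  then show ?case using digit.IH digit.hyps naf_value.digit by blast
qed (rule naf_value.zero)

text \<open>Stated for pairs of positions, the gap condition survives digitwise limits. The index
  type is general because finite expansions use \<open>nat\<close> and their limits
  \<open>int\<close>.\<close>

definition separated :: "nat \<Rightarrow> ('a::linordered_semidom \<Rightarrow> complex) \<Rightarrow> bool" where
  "separated w \<eta> \<longleftrightarrow> (\<forall>i j. i < j \<longrightarrow> \<eta> i \<noteq> 0 \<longrightarrow> \<eta> j \<noteq> 0 \<longrightarrow> i + of_nat w \<le> j)"

lemma naf_value_digits:
  assumes "naf_value \<tau> w D x n" and D0: "0 \<in> D" and w: "0 < w"
  shows "\<exists>\<eta> :: nat \<Rightarrow> complex. range \<eta> \<subseteq> D \<and> (\<forall>j\<ge>n. \<eta> j = 0) \<and> separated w \<eta> \<and>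
           x = (\<Sum>j<n. \<eta> j * \<tau> ^ j)"
  using assms(1)
proof induction
  case (zero n)
  show ?case by (rule exI[of _ "\<lambda>_. 0"]) (use D0 in \<open>auto simp: separated_def\<close>)
next
  case (shift y n)
  then obtain \<eta> :: "nat \<Rightarrow> complex" where \<eta>: "range \<eta> \<subseteq> D" "\<forall>j\<ge>n. \<eta> j = 0" "separated w \<eta>"
      "y = (\<Sum>j<n. \<eta> j * \<tau> ^ j)" by blast
  define \<eta>' where "\<eta>' j = (case j of 0 \<Rightarrow> 0 | Suc i \<Rightarrow> \<eta> i)" for j
  have "\<tau> * y = (\<Sum>j<Suc n. \<eta>' j * \<tau> ^ j)"
    unfolding sum.lessThan_Suc_shift \<eta>(4) by (simp add: \<eta>'_def sum_distrib_left mult_ac)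
  moreover have "range \<eta>' \<subseteq> D" "\<forall>j\<ge>Suc n. \<eta>' j = 0"
    using \<eta>(1,2) D0 by (auto simp: \<eta>'_def subset_iff split: nat.split)
  moreover have "separated w \<eta>'"
    using \<eta>(3) by (auto simp: separated_def \<eta>'_def split: nat.splits)
  ultimately show ?case by blast
next
  case (digit d y n)
  then obtain \<eta> :: "nat \<Rightarrow> complex" where \<eta>: "range \<eta> \<subseteq> D" "\<forall>j\<ge>n. \<eta> j = 0" "separated w \<eta>"
      "y = (\<Sum>j<n. \<eta> j * \<tau> ^ j)" by blast
  define \<eta>' where "\<eta>' j = (if j = 0 then d else if j < w then 0 else \<eta> (j - w))" for j
  have "(\<Sum>j<w. \<eta>' j * \<tau> ^ j) = (\<Sum>j<w. if j = 0 then d else 0)"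
    by (intro sum.cong) (auto simp: \<eta>'_def)
  also have "\<dots> = d" using w by simp
  finally have "(\<Sum>j<w + n. \<eta>' j * \<tau> ^ j) = d + (\<Sum>j=w..<w+n. \<eta>' j * \<tau> ^ j)"
    using sum.atLeastLessThan_concat[of 0 w "w + n" "\<lambda>j. \<eta>' j * \<tau> ^ j"]
    by (simp add: lessThan_atLeast0)
  also have "(\<Sum>j=w..<w+n. \<eta>' j * \<tau> ^ j) = (\<Sum>j<n. \<eta>' (j + w) * \<tau> ^ (j + w))"
    using sum.shift_bounds_nat_ivl[of "\<lambda>j. \<eta>' j * \<tau> ^ j" 0 w n]
    by (simp add: lessThan_atLeast0 add.commute)
  also have "\<dots> = \<tau> ^ w * y"
    using w by (simp add: \<eta>'_def \<eta>(4) sum_distrib_left power_add mult_ac)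
  finally have "d + \<tau> ^ w * y = (\<Sum>j<n + w. \<eta>' j * \<tau> ^ j)" by (simp add: add.commute)
  moreover have "range \<eta>' \<subseteq> D" "\<forall>j\<ge>n + w. \<eta>' j = 0"
    using \<eta>(1,2) D0 digit.hyps w by (auto simp: \<eta>'_def subset_iff)
  moreover have "separated w \<eta>'"
    unfolding separated_def
  proof (intro allI impI)
    fix i j :: nat assume ij: "i < j" "\<eta>' i \<noteq> 0" "\<eta>' j \<noteq> 0"
    then have "w \<le> j" "\<eta> (j - w) \<noteq> 0" by (auto simp: \<eta>'_def split: if_splits)
    moreover have "i = 0 \<or> w \<le> i \<and> \<eta> (i - w) \<noteq> 0"
      using ij by (auto simp: \<eta>'_def split: if_splits)
    ultimately show "i + of_nat w \<le> j"
      using \<eta>(3)[unfolded separated_def, rule_format, of "i - w" "j - w"] ij(1) by fastforce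
  qed
  ultimately show ?case by blast
qed

lemma card_window_le_1:
  fixes \<eta> :: "int \<Rightarrow> complex"
  assumes "separated w \<eta>"
  shows "card {i \<in> {j..<j + int w}. \<eta> i \<noteq> 0} \<le> 1"
proof -
  have "i = i'" if "i \<in> {j..<j + int w}" "\<eta> i \<noteq> 0" "i' \<in> {j..<j + int w}" "\<eta> i' \<noteq> 0" for i i'
    using assms[unfolded separated_def, rule_format, of i i'] that
      assms[unfolded separated_def, rule_format, of i' i] by fastforce
  then have "card {i \<in> {j..<j + int w}. \<eta> i \<noteq> 0} \<le> Suc 0"
    by (subst card_le_Suc0_iff_eq) (auto intro: finite_subset[of _ "{j..<j + int w}"])
  then show ?thesis by simp
qed

lemma left_length_finite:
  assumes "\<And>j. j \<ge> M \<Longrightarrow> \<eta> j = 0"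
  shows "left_length \<eta> < \<infinity>"
proof -
  have "left_length \<eta> \<le> ereal (max 0 (of_int M))"
    unfolding left_length_def
  proof (rule Sup_least)
    fix x assume "x \<in> {0} \<union> {ereal (of_int (j + 1)) |j. \<eta> j \<noteq> 0}"
    then consider "x = 0" | j where "x = ereal (of_int (j + 1))" "\<eta> j \<noteq> 0" by blast
    then show "x \<le> ereal (max 0 (of_int M))"
    proof cases
      case (2 j)
      then have "j + 1 \<le> M" using assms[of j] by linarith
      then show ?thesis using 2(1)
        by (metis ereal_less_eq(3) max.coboundedI2 of_int_le_iff)
    qed (simp add: zero_ereal_def)
  qed
  then show ?thesis using le_less_trans less_ereal.simps(4) by blast
qed

text \<open>This is all that the limit argument takes from the geometry. One constant
  \<open>\<rho>\<close> is both the covering radius of the lattice and, scaled by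
  \<open>cmod \<tau> ^ w\<close>, a bound for the digits.\<close>

locale naf_system =
  fixes \<tau> :: complex and w :: nat and L D :: "complex set" and \<rho> :: real
  assumes norm_base: "1 < cmod \<tau>"
    and w_pos: "0 < w"
    and zero_digit: "0 \<in> D"
    and finite_digits: "finite D"
    and finite_ball: "finite {x \<in> L. cmod x \<le> c}"
    and cover: "\<exists>x\<in>L. cmod (z - x) \<le> \<rho>"
    and step: "x \<in> L \<Longrightarrow> (\<exists>y\<in>L. x = \<tau> * y) \<or>
      (\<exists>d\<in>D. \<exists>y\<in>L. x = d + \<tau> ^ w * y \<and> cmod d \<le> cmod \<tau> ^ w * \<rho>)"
    and terminates: "x \<in> L \<Longrightarrow> \<exists>n. naf_value \<tau> w D x n"
begin

lemma base_nonzero: "\<tau> \<noteq> 0"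
  using norm_base by auto

lemma rho_nonneg: "0 \<le> \<rho>"
  using cover[of 0] norm_ge_zero order_trans by blast

text \<open>The invariant \<open>cmod x \<le> B * cmod \<tau> ^ n + R\<close> survives both kinds of division step
  because \<open>R\<close> is the fixed point of \<open>R \<mapsto> R / cmod \<tau> ^ w + \<rho>\<close>; after about \<open>n\<close> digits the
  remainder lies in a fixed finite set.\<close>

lemma naf_value_uniform_length:
  assumes B: "0 \<le> B"
  shows "\<exists>M. \<forall>n. \<forall>x\<in>L. cmod x \<le> B * cmod \<tau> ^ n \<longrightarrow> naf_value \<tau> w D x (n + M)"
proof -
  define T A where "T = cmod \<tau>" and "A = T ^ w"
  have T: "1 < T" "0 < T" using norm_base by (auto simp: T_def)
  have A: "1 < A" using T w_pos by (simp add: A_def)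
  define R where "R = \<rho> * A / (A - 1)"
  have R0: "0 \<le> R" using rho_nonneg A by (simp add: R_def)
  have R: "R / A + \<rho> = R" using A by (simp add: R_def field_simps)
  define F where "F = {x \<in> L. cmod x \<le> B + R}"
  obtain f where f: "\<And>x. x \<in> L \<Longrightarrow> naf_value \<tau> w D x (f x)" using terminates by metis
  define M0 where "M0 = Max (insert 0 (f ` F))"
  have F: "naf_value \<tau> w D x M0" if "x \<in> F" for x
  proof (rule naf_value_mono)
    show "naf_value \<tau> w D x (f x)" using f that by (simp add: F_def)
    show "f x \<le> M0" unfolding M0_def using that finite_ball[of "B + R"] by (auto simp: F_def)
  qed
  \<comment> \<open>The extra \<open>w\<close> pays for a last digit step taken when fewer than
    \<open>w\<close> of the \<open>n\<close> positions are left; its remainder is already in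
    \<open>F\<close>.\<close>
  have "naf_value \<tau> w D x (n + (M0 + w))" if "x \<in> L" "cmod x \<le> B * T ^ n + R" for n x
    using that
  proof (induction n arbitrary: x rule: less_induct)
    case (less n)
    show ?case
    proof (cases "n = 0")
      case True
      then have "x \<in> F" using less.prems by (simp add: F_def)
      then show ?thesis using F naf_value_mono by (meson le_add1 le_add2 order_trans)
    next
      case False
      consider y where "y \<in> L" "x = \<tau> * y"
        | d y where "d \<in> D" "y \<in> L" "x = d + \<tau> ^ w * y" "cmod d \<le> A * \<rho>"
        using step[OF less.prems(1)] unfolding A_def T_def by blast
      then show ?thesis
      proof cases
        case (1 y)
        obtain k where k: "n = Suc k" using False not0_implies_Suc by blast
        have "T * cmod y \<le> T * (B * T ^ k) + R"
          using less.prems(2) by (simp add: 1 k norm_mult T_def mult_ac)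
        also have "R \<le> T * R" using R0 T by (simp add: mult_right_le_one_le mult_le_cancel_right1)
        finally have "T * cmod y \<le> T * (B * T ^ k + R)" by (simp add: algebra_simps)
        then have "cmod y \<le> B * T ^ k + R" using T by simp
        then have "naf_value \<tau> w D y (k + (M0 + w))" using less.IH[of k] k 1 by simp
        then show ?thesis using naf_value.shift[of \<tau> w D y] 1 k by simp
      next
        case (2 d y)
        have "A * cmod y = cmod (x - d)" by (simp add: 2 norm_mult norm_power A_def T_def)
        also have "\<dots> \<le> cmod x + cmod d" by (rule norm_triangle_ineq4)
        also have "\<dots> \<le> B * T ^ n + R + A * \<rho>" using less.prems 2 by simp
        finally have "cmod y \<le> (B * T ^ n + R + A * \<rho>) / A"
          using A by (simp add: field_simps)
        also have "\<dots> = B * (T ^ n / A) + (R / A + \<rho>)"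
          using A by (simp add: add_divide_distrib)
        finally have y: "cmod y \<le> B * (T ^ n / A) + R" by (simp add: R)
        show ?thesis
        proof (cases "w \<le> n")
          case True
          then have "T ^ n / A = T ^ (n - w)" using T by (simp add: A_def power_diff)
          then have "naf_value \<tau> w D y (n - w + (M0 + w))"
            using less.IH[of "n - w"] y 2 w_pos True by simp
          then have "naf_value \<tau> w D x (n - w + (M0 + w) + w)"
            using naf_value.digit 2 by blast
          then show ?thesis using True by (simp add: add.commute add.left_commute)
        next
          case False
          then have "T ^ n / A \<le> 1" using T by (simp add: A_def power_increasing)
          then have "B * (T ^ n / A) \<le> B" using B mult_left_le by blast
          then have "y \<in> F" using y 2 by (simp add: F_def)
          then have "naf_value \<tau> w D x (M0 + w)" using naf_value.digit 2 F by blast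
          then show ?thesis using naf_value_mono le_add2 by blast
        qed
      qed
    qed
  qed
  then have "\<forall>n. \<forall>x\<in>L. cmod x \<le> B * cmod \<tau> ^ n \<longrightarrow> naf_value \<tau> w D x (n + (M0 + w))"
    using R0 by (auto simp: T_def)
  then show ?thesis by blast
qed

text \<open>The series run over \<open>int M - 1 - int k\<close>, from the leading position
  downwards, so all approximants share the index set of natural numbers and can be compared term by
  term.\<close>

lemma approximation_digits:
  obtains M :: nat and \<eta> :: "nat \<Rightarrow> int \<Rightarrow> complex" where
    "\<And>n. range (\<eta> n) \<subseteq> D" "\<And>n j. j \<ge> int M \<Longrightarrow> \<eta> n j = 0" "\<And>n. separated w (\<eta> n)"
    "(\<lambda>n. \<Sum>k. \<eta> n (int M - 1 - int k) * \<tau> powi (int M - 1 - int k)) \<longlonglongrightarrow> z"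
proof -
  obtain x where x: "\<And>n. x n \<in> L" "\<And>n. cmod (\<tau> ^ n * z - x n) \<le> \<rho>"
    using cover[of "\<tau> ^ _ * z"] by metis
  have xn: "cmod (x n) \<le> (cmod z + \<rho>) * cmod \<tau> ^ n" for n
  proof -
    have "cmod (x n) \<le> cmod (\<tau> ^ n * z) + cmod (\<tau> ^ n * z - x n)"
      by (metis norm_minus_commute norm_triangle_sub)
    also have "\<dots> \<le> cmod z * cmod \<tau> ^ n + \<rho> * 1" using x by (simp add: norm_mult norm_power mult.commute)
    also have "\<dots> \<le> cmod z * cmod \<tau> ^ n + \<rho> * cmod \<tau> ^ n"
      using rho_nonneg norm_base by (intro add_left_mono mult_left_mono) auto
    finally show ?thesis by (simp add: algebra_simps)
  qed
  obtain M where M: "\<And>n y. y \<in> L \<Longrightarrow> cmod y \<le> (cmod z + \<rho>) * cmod \<tau> ^ n \<Longrightarrow> naf_value \<tau> w D y (n + M)"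
    using naf_value_uniform_length[of "cmod z + \<rho>"] rho_nonneg by auto
  have "\<exists>\<eta> :: nat \<Rightarrow> complex. range \<eta> \<subseteq> D \<and> (\<forall>j\<ge>n + M. \<eta> j = 0) \<and> separated w \<eta> \<and>
           x n = (\<Sum>j<n + M. \<eta> j * \<tau> ^ j)" for n
    using naf_value_digits[OF M[OF x(1) xn] zero_digit w_pos] .
  then obtain \<epsilon> :: "nat \<Rightarrow> nat \<Rightarrow> complex" where \<epsilon>: "\<And>n. range (\<epsilon> n) \<subseteq> D"
      "\<And>n j. j \<ge> n + M \<Longrightarrow> \<epsilon> n j = 0" "\<And>n. separated w (\<epsilon> n)"
      "\<And>n. x n = (\<Sum>j<n + M. \<epsilon> n j * \<tau> ^ j)" by metis
  \<comment> \<open>Shifting by \<open>n\<close> divides the value by \<open>\<tau> ^ n\<close>. The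
    guard is essential, since \<open>nat\<close> would send all positions below
    \<open>- int n\<close> to the lowest digit.\<close>
  define \<eta> where "\<eta> n j = (if j + int n < 0 then 0 else \<epsilon> n (nat (j + int n)))" for n :: nat and j :: int
  have "(\<lambda>k. \<eta> n (int M - 1 - int k) * \<tau> powi (int M - 1 - int k)) sums (x n / \<tau> ^ n)" for n
  proof -
    have "(\<lambda>k. \<eta> n (int M - 1 - int k) * \<tau> powi (int M - 1 - int k)) sums
        (\<Sum>k<n + M. \<eta> n (int M - 1 - int k) * \<tau> powi (int M - 1 - int k))"
      by (rule sums_finite) (auto simp: \<eta>_def)
    also have "(\<Sum>k<n + M. \<eta> n (int M - 1 - int k) * \<tau> powi (int M - 1 - int k))
        = (\<Sum>j<n + M. \<eta> n (int j - int n) * \<tau> powi (int j - int n))"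
      by (rule sum.reindex_bij_witness[of _ "\<lambda>j. n + M - 1 - j" "\<lambda>j. n + M - 1 - j"])
         (auto simp: of_nat_diff algebra_simps)
    also have "\<dots> = (\<Sum>j<n + M. \<epsilon> n j * \<tau> ^ j / \<tau> ^ n)"
      using base_nonzero by (intro sum.cong) (auto simp: \<eta>_def power_int_diff)
    also have "\<dots> = x n / \<tau> ^ n" by (simp add: \<epsilon>(4) sum_divide_distrib)
    finally show ?thesis .
  qed
  then have sums: "(\<Sum>k. \<eta> n (int M - 1 - int k) * \<tau> powi (int M - 1 - int k)) = x n / \<tau> ^ n" for n
    by (simp add: sums_iff)
  have "(\<lambda>n. x n / \<tau> ^ n - z) \<longlonglongrightarrow> 0"
  proof (rule Lim_null_comparison)
    show "(\<lambda>n. \<rho> * inverse (cmod \<tau>) ^ n) \<longlonglongrightarrow> 0"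
      using norm_base by (intro tendsto_mult_right_zero LIMSEQ_power_zero) (simp add: inverse_less_1_iff)
    have "norm (x n / \<tau> ^ n - z) \<le> \<rho> * inverse (cmod \<tau>) ^ n" for n
    proof -
      have "x n / \<tau> ^ n - z = (x n - \<tau> ^ n * z) / \<tau> ^ n" using base_nonzero by (simp add: field_simps)
      then show ?thesis using x(2)[of n] norm_base
        by (simp add: norm_mult norm_inverse norm_power norm_minus_commute divide_inverse
            power_inverse mult_right_mono)
    qed
    then show "\<forall>\<^sub>F n in sequentially. norm (x n / \<tau> ^ n - z) \<le> \<rho> * inverse (cmod \<tau>) ^ n" by simp
  qed
  then have lim: "(\<lambda>n. x n / \<tau> ^ n) \<longlonglongrightarrow> z" by (rule LIM_zero_cancel)
  show thesis
  proof
    show "range (\<eta> n) \<subseteq> D" for n using \<epsilon>(1) zero_digit by (auto simp: \<eta>_def)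
    show "\<eta> n j = 0" if "j \<ge> int M" for n j using that \<epsilon>(2) by (auto simp: \<eta>_def)
    show "separated w (\<eta> n)" for n
      unfolding separated_def
    proof (intro allI impI)
      fix i j assume "i < j" "\<eta> n i \<noteq> 0" "\<eta> n j \<noteq> 0"
      then show "i + of_nat w \<le> j"
        using \<epsilon>(3)[of n, unfolded separated_def, rule_format, of "nat (i + int n)" "nat (j + int n)"]
        by (auto simp: \<eta>_def split: if_splits)
    qed
    show "(\<lambda>n. \<Sum>k. \<eta> n (int M - 1 - int k) * \<tau> powi (int M - 1 - int k)) \<longlonglongrightarrow> z"
      unfolding sums by (rule lim)
  qed
qed

section \<open>Passage to the limit by compactness\<close>

lemma constant_subsequence:
  fixes f :: "nat \<Rightarrow> complex"
  assumes "range f \<subseteq> D"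
  shows "\<exists>r::nat \<Rightarrow> nat. strict_mono r \<and> (\<exists>c. \<forall>i. f (r i) = c)"
proof -
  have "\<exists>c. infinite {n. f n = c}"
    using pigeonhole_infinite[of "UNIV :: nat set" f] finite_subset[OF assms finite_digits] by auto
  then obtain c where "infinite {n. f n = c}" by blast
  then obtain r :: "nat \<Rightarrow> nat" where "strict_mono r" "\<And>i. r i \<in> {n. f n = c}"
    using infinite_enumerate by blast
  then show ?thesis by auto
qed

text \<open>Membership in \<open>D\<close> and separation involve one or two positions, so they hold
  for the limit because they hold far along the diagonal sequence. The value passes to the limit by
  dominated convergence of series.\<close>

theorem expansion_exists:
  "\<exists>\<eta> :: int \<Rightarrow> complex. range \<eta> \<subseteq> D \<and> separated w \<eta> \<and> (\<exists>M. \<forall>j\<ge>M. \<eta> j = 0) \<and>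
     ((\<lambda>j. \<eta> j * \<tau> powi j) has_sum z) UNIV"
proof -
  obtain M :: nat and \<eta> :: "nat \<Rightarrow> int \<Rightarrow> complex" where
    \<eta>: "\<And>n. range (\<eta> n) \<subseteq> D" "\<And>n j. j \<ge> int M \<Longrightarrow> \<eta> n j = 0" "\<And>n. separated w (\<eta> n)"
    and lim: "(\<lambda>n. \<Sum>k. \<eta> n (int M - 1 - int k) * \<tau> powi (int M - 1 - int k)) \<longlonglongrightarrow> z"
    by (rule approximation_digits[of z], rule that)
  define pos where "pos k = int M - 1 - int k" for k :: nat
  interpret subseqs "\<lambda>k s. \<exists>c. \<forall>i. \<eta> (s i) (pos k) = c"
  proof
    fix k and s :: "nat \<Rightarrow> nat"
    have "range (\<lambda>i. \<eta> (s i) (pos k)) \<subseteq> D" using \<eta>(1) by auto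
    from constant_subsequence[OF this]
    show "\<exists>r :: nat \<Rightarrow> nat. strict_mono r \<and> (\<exists>c. \<forall>i. \<eta> ((s \<circ> r) i) (pos k) = c)" by simp
  qed
  have "\<exists>c. \<forall>i. \<eta> ((diagseq \<circ> ((+) (Suc k))) i) (pos k) = c" for k
    by (rule diagseq_holds) auto
  \<comment> \<open>Beyond index \<open>k\<close> the diagonal sequence is a subsequence of the one
    chosen at stage \<open>k\<close>, so the digit at \<open>pos k\<close> no longer
    changes.\<close>
  then obtain c where c: "\<And>k i. \<eta> (diagseq (Suc k + i)) (pos k) = c k"
    unfolding o_apply by metis
  define \<zeta> where "\<zeta> j = (if j \<ge> int M then 0 else c (nat (int M - 1 - j)))" for j
  have \<zeta>_pos: "\<zeta> (pos k) = c k" for k by (simp add: \<zeta>_def pos_def)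
  have \<zeta>_eq: "\<forall>\<^sub>F n in sequentially. \<eta> (diagseq n) j = \<zeta> j" for j
  proof (cases "j \<ge> int M")
    case False
    then have "pos (nat (int M - 1 - j)) = j" by (simp add: pos_def)
    moreover define k where "k = nat (int M - 1 - j)"
    ultimately have "j = pos k" by simp
    have "\<eta> (diagseq n) j = \<zeta> j" if "n \<ge> Suc k" for n
      using c[of k "n - Suc k"] that unfolding \<open>j = pos k\<close> \<zeta>_pos by simp
    then show ?thesis by (rule eventually_sequentiallyI)
  qed (simp add: \<zeta>_def \<eta>(2))
  have digits: "range \<zeta> \<subseteq> D"
  proof (rule image_subsetI)
    fix j
    obtain n where "\<eta> (diagseq n) j = \<zeta> j"
      using eventually_happens'[OF sequentially_bot \<zeta>_eq[of j]] by blast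
    then show "\<zeta> j \<in> D" using subsetD[OF \<eta>(1) rangeI, of "diagseq n" j] by simp
  qed
  have sep: "separated w \<zeta>"
    unfolding separated_def
  proof (intro allI impI)
    fix i j assume ij: "i < j" "\<zeta> i \<noteq> 0" "\<zeta> j \<noteq> 0"
    obtain n where "\<eta> (diagseq n) i = \<zeta> i \<and> \<eta> (diagseq n) j = \<zeta> j"
      using eventually_happens'[OF sequentially_bot eventually_conj[OF \<zeta>_eq[of i] \<zeta>_eq[of j]]]
      by blast
    then show "i + of_nat w \<le> j"
      using \<eta>(3)[of "diagseq n", unfolded separated_def, rule_format, of i j] ij by simp
  qed
  obtain C where C: "\<And>d. d \<in> D \<Longrightarrow> cmod d \<le> C"
    using finite_imp_bounded[OF finite_digits] unfolding bounded_iff by blast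
  \<comment> \<open>A geometric majorant: \<open>pos k\<close> equals \<open>M - (k + 1)\<close> and
    all digits are bounded by \<open>C\<close>.\<close>
  define g where "g k = C * (cmod \<tau> ^ M * inverse (cmod \<tau>) ^ Suc k)" for k
  have g: "summable g"
    unfolding g_def using norm_base
    by (intro summable_mult, subst summable_Suc_iff)
       (simp add: summable_geometric inverse_less_1_iff)
  have bound: "norm (d * \<tau> powi (pos k)) \<le> g k" if "d \<in> D" for d k
  proof -
    have "\<tau> powi (pos k) = \<tau> powi (int M - int (Suc k))" by (simp add: pos_def algebra_simps)
    also have "\<dots> = \<tau> ^ M / \<tau> ^ Suc k"
      using base_nonzero by (simp del: of_nat_Suc power_Suc add: power_int_diff)
    finally have "cmod (\<tau> powi (pos k)) = cmod \<tau> ^ M * inverse (cmod \<tau>) ^ Suc k"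
      by (simp only: norm_mult norm_inverse norm_power divide_inverse power_inverse)
    then show ?thesis unfolding g_def norm_mult
      using C[OF that] by (simp add: mult_right_mono)
  qed
  have "(\<lambda>n. \<Sum>k. \<eta> (diagseq n) (pos k) * \<tau> powi (pos k)) \<longlonglongrightarrow> (\<Sum>k. \<zeta> (pos k) * \<tau> powi (pos k))"
  proof (rule conjunct2[OF conjunct2[OF tannerys_theorem[where M = g
          and a = "\<lambda>k n. \<eta> (diagseq n) (pos k) * \<tau> powi pos k"]]])
    show "(\<lambda>n. \<eta> (diagseq n) (pos k) * \<tau> powi pos k) \<longlonglongrightarrow> \<zeta> (pos k) * \<tau> powi pos k" for k
      by (rule tendsto_eventually) (use \<zeta>_eq[of "pos k"] in eventually_elim, simp)
    have "\<forall>x. norm (\<eta> (diagseq (snd x)) (pos (fst x)) * \<tau> powi pos (fst x)) \<le> g (fst x)"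
      using bound[OF subsetD[OF \<eta>(1) rangeI]] by blast
    then show "\<forall>\<^sub>F (k, n) in sequentially \<times>\<^sub>F sequentially.
        norm (\<eta> (diagseq n) (pos k) * \<tau> powi pos k) \<le> g k"
      by (intro always_eventually) (auto simp: case_prod_unfold)
  qed (use g in auto)
  moreover have "(\<lambda>n. \<Sum>k. \<eta> (diagseq n) (pos k) * \<tau> powi (pos k)) \<longlonglongrightarrow> z"
    using LIMSEQ_subseq_LIMSEQ[OF lim subseq_diagseq] by (simp add: o_def pos_def)
  ultimately have val: "(\<Sum>k. \<zeta> (pos k) * \<tau> powi (pos k)) = z" by (rule LIMSEQ_unique)
  have sm: "summable (\<lambda>k. norm (\<zeta> (pos k) * \<tau> powi (pos k)))"
    by (rule summable_comparison_test'[OF g, of 0]) (use bound[OF subsetD[OF digits rangeI]] in simp)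
  have "((\<lambda>k. \<zeta> (pos k) * \<tau> powi (pos k)) has_sum z) UNIV"
    using norm_summable_imp_has_sum[OF sm summable_sums[OF summable_norm_cancel[OF sm]]]
    unfolding val .
  then have "((\<lambda>j. \<zeta> j * \<tau> powi j) has_sum z) (range pos)"
    by (subst has_sum_reindex) (simp_all add: o_def pos_def inj_on_def)
  \<comment> \<open>Positions outside \<open>range pos\<close> are those from \<open>int M\<close>
    upwards, so the sum extends to all integers.\<close>
  moreover have "\<zeta> j = 0" if "j \<notin> range pos" for j
  proof (rule ccontr)
    assume "\<zeta> j \<noteq> 0"
    then have "j = pos (nat (int M - 1 - j))" by (auto simp: \<zeta>_def pos_def split: if_splits)
    then show False using that by blast
  qed
  ultimately have "((\<lambda>j. \<zeta> j * \<tau> powi j) has_sum z) UNIV"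
    by (subst has_sum_cong_neutral[where T = "range pos"]) simp_all
  moreover have "\<forall>j\<ge>int M. \<zeta> j = 0" by (simp add: \<zeta>_def)
  ultimately show ?thesis using digits sep by (intro exI[of _ \<zeta>]) auto
qed

end

section \<open>Finite expansions of lattice elements\<close>

lemma abs_less_if_square_less: "m\<^sup>2 < k\<^sup>2 \<Longrightarrow> 0 \<le> k \<Longrightarrow> \<bar>m\<bar> < k" for m k :: int
  using power2_less_imp_less[of "\<bar>m\<bar>" k] by simp

locale wnaf_base = imaginary_quadratic +
  fixes w :: nat
  assumes w: "w \<ge> 2"
begin

text \<open>Dividing by \<open>\<tau> ^ w\<close> turns a residue class into a translate of the
  whole lattice, which meets the restricted cell exactly once by the tiling.\<close>

lemma residue_representative:
  assumes x: "x \<in> zring \<tau>"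
  shows "\<exists>!d. d \<in> residue_class \<tau> w x \<and> d \<in> (\<lambda>z. \<tau> ^ w * z) ` restricted_voronoi \<tau>"
proof (rule ex_ex1I)
  have A: "\<tau> ^ w \<noteq> 0" using base_nonzero by simp
  obtain y where y: "y \<in> zring \<tau>" "x / \<tau> ^ w - y \<in> restricted_voronoi \<tau>"
    using restricted_voronoi_tiles[of "x / \<tau> ^ w"] by blast
  have "x - \<tau> ^ w * y \<in> residue_class \<tau> w x"
    unfolding residue_class_def zring_dvd_def
    using x y zring_diff zring_mult zring_power[OF zring_base] zring_uminus
    by (auto intro!: bexI[of _ "- y"])
  moreover have "x - \<tau> ^ w * y = \<tau> ^ w * (x / \<tau> ^ w - y)" using A by (simp add: algebra_simps)
  ultimately show "\<exists>d. d \<in> residue_class \<tau> w x \<and> d \<in> (\<lambda>z. \<tau> ^ w * z) ` restricted_voronoi \<tau>"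
    using y by blast
  fix d d'
  assume "d \<in> residue_class \<tau> w x \<and> d \<in> (\<lambda>z. \<tau> ^ w * z) ` restricted_voronoi \<tau>"
    "d' \<in> residue_class \<tau> w x \<and> d' \<in> (\<lambda>z. \<tau> ^ w * z) ` restricted_voronoi \<tau>"
  then obtain e e' u u' where
    d: "e \<in> zring \<tau>" "d - x = \<tau> ^ w * e" "u \<in> restricted_voronoi \<tau>" "d = \<tau> ^ w * u"
    and d': "e' \<in> zring \<tau>" "d' - x = \<tau> ^ w * e'" "u' \<in> restricted_voronoi \<tau>" "d' = \<tau> ^ w * u'"
    unfolding residue_class_def zring_dvd_def by blast
  have "u = x / \<tau> ^ w - (- e)" "u' = x / \<tau> ^ w - (- e')"
    using d(2,4) d'(2,4) A by (auto simp: field_simps)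
  then have "- e = - e'"
    using restricted_voronoi_tiles[of "x / \<tau> ^ w"] zring_uminus d(1,3) d'(1,3) by metis
  then show "d = d'" using d(2) d'(2) by (metis diff_add_cancel minus_equation_iff)
qed

text \<open>This recognizes a concrete element as a digit: it represents its own class when it lies
  in the scaled cell.\<close>

lemma digitI:
  assumes "d \<in> zring \<tau>" "\<not> zring_dvd \<tau> \<tau> d" "d / \<tau> ^ w \<in> restricted_voronoi \<tau>"
  shows "d \<in> digit_set \<tau> w"
proof -
  have "d \<in> residue_class \<tau> w d"
    using assms(1) zring_of_int[of 0] by (auto simp: residue_class_def zring_dvd_def)
  moreover have "d = \<tau> ^ w * (d / \<tau> ^ w)" using base_nonzero by simp
  ultimately have "(THE d'. d' \<in> residue_class \<tau> w d \<and> d' \<in> (\<lambda>z. \<tau> ^ w * z) ` restricted_voronoi \<tau>) = d"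
    using assms(3) by (intro the1_equality[OF residue_representative[OF assms(1)]]) blast
  then show ?thesis unfolding digit_set_def using assms(1,2)
    by (intro UnI2 CollectI exI[of _ d] conjI) simp_all
qed

lemma scaled_cell_norm:
  assumes "d \<in> (\<lambda>z. \<tau> ^ w * z) ` restricted_voronoi \<tau>"
  shows "cmod d \<le> cmod \<tau> ^ w * (sqrt (1 + of_int q) / 2)"
proof -
  obtain z where "z \<in> restricted_voronoi \<tau>" "d = \<tau> ^ w * z" using assms by blast
  then show ?thesis unfolding norm_mult norm_power
    using mult_left_mono[OF restricted_voronoi_norm zero_le_power[OF norm_ge_zero]]
    by (simp add: norm_mult norm_power)
qed

lemma digit_decomposition:
  assumes x: "x \<in> zring \<tau>" "\<not> zring_dvd \<tau> \<tau> x"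
  obtains d y where "d \<in> digit_set \<tau> w" "y \<in> zring \<tau>" "x = d + \<tau> ^ w * y"
    "cmod d \<le> cmod \<tau> ^ w * (sqrt (1 + of_int q) / 2)"
proof -
  define d where "d = (THE d. d \<in> residue_class \<tau> w x \<and> d \<in> (\<lambda>z. \<tau> ^ w * z) ` restricted_voronoi \<tau>)"
  have "d \<in> digit_set \<tau> w" unfolding digit_set_def d_def using x by blast
  moreover have d: "d \<in> residue_class \<tau> w x \<and> d \<in> (\<lambda>z. \<tau> ^ w * z) ` restricted_voronoi \<tau>"
    unfolding d_def by (rule theI'[OF residue_representative[OF x(1)]])
  then obtain e where "e \<in> zring \<tau>" "d - x = \<tau> ^ w * e"
    unfolding residue_class_def zring_dvd_def by blast
  then have "- e \<in> zring \<tau>" "x = d + \<tau> ^ w * (- e)" by (auto simp: zring_uminus algebra_simps)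
  moreover have "cmod d \<le> cmod \<tau> ^ w * (sqrt (1 + of_int q) / 2)"
    using d scaled_cell_norm by blast
  ultimately show thesis using that by blast
qed

lemma finite_digit_set: "finite (digit_set \<tau> w)"
proof -
  have "digit_set \<tau> w \<subseteq> {0} \<union> {x \<in> zring \<tau>. cmod x \<le> cmod \<tau> ^ w * (sqrt (1 + of_int q) / 2)}"
  proof
    fix d assume "d \<in> digit_set \<tau> w"
    then consider "d = 0" | x where "x \<in> zring \<tau>"
      "d = (THE d. d \<in> residue_class \<tau> w x \<and> d \<in> (\<lambda>z. \<tau> ^ w * z) ` restricted_voronoi \<tau>)"
      unfolding digit_set_def by blast
    then show "d \<in> {0} \<union> {x \<in> zring \<tau>. cmod x \<le> cmod \<tau> ^ w * (sqrt (1 + of_int q) / 2)}"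
    proof cases
      case (2 x)
      then have "d \<in> residue_class \<tau> w x \<and> d \<in> (\<lambda>z. \<tau> ^ w * z) ` restricted_voronoi \<tau>"
        using theI'[OF residue_representative] by blast
      then show ?thesis
        using scaled_cell_norm by (auto simp: residue_class_def)
    qed simp
  qed
  then show ?thesis by (rule finite_subset) (intro finite_UnI finite_zring_ball finite.intros)
qed

lemma unit_not_dvd:
  assumes "cmod x = 1"
  shows "\<not> zring_dvd \<tau> \<tau> x"
proof
  assume "zring_dvd \<tau> \<tau> x"
  then obtain e where e: "e \<in> zring \<tau>" "x = \<tau> * e" by (auto simp: zring_dvd_def)
  then have "e \<noteq> 0" using assms by auto
  then have "1 \<le> cmod e" using e(1) zring_norm_ge_1 by blast
  then have "1 * 1 < cmod \<tau> * cmod e" using norm_base by (intro mult_less_le_imp_less) auto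
  then show False using assms e(2) by (simp add: norm_mult)
qed

section \<open>Descent on the modulus\<close>

abbreviation representable :: "complex \<Rightarrow> bool" where
  "representable x \<equiv> \<exists>n. naf_value \<tau> w (digit_set \<tau> w) x n"

lemma representable_0: "representable 0"
  using naf_value.zero by blast

lemma representable_shift: "representable y \<Longrightarrow> representable (\<tau> * y)"
  using naf_value.shift by blast

lemma representable_digit:
  "d \<in> digit_set \<tau> w \<Longrightarrow> representable y \<Longrightarrow> x = d + \<tau> ^ w * y \<Longrightarrow> representable x"
  using naf_value.digit by blast

lemma digit_representable: "d \<in> digit_set \<tau> w \<Longrightarrow> representable d"
  using representable_digit[OF _ representable_0] by simp

text \<open>With A for \<open>cmod \<tau> ^ w\<close>, the assumption \<open>A / 2 \<le> X\<close>
  reduces the claim to \<open>sqrt (1 + q) < A - 1\<close>. This holds for q at least 4 and for w at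
  least 3. For q = 3, w = 2 both sides are 2, and for q = w = 2 it fails, so integrality of the
  squared modulus has to help.\<close>

lemma norm_decrease:
  assumes X: "X\<^sup>2 = real N" "cmod \<tau> ^ w / 2 \<le> X" and exc: "\<not> (q = 2 \<and> w = 2 \<and> N \<le> 3)"
  shows "X / cmod \<tau> ^ w + sqrt (1 + of_int q) / 2 < X"
proof -
  define T A where "T = cmod \<tau>" and "A = T ^ w"
  have T: "1 < T" "T\<^sup>2 = of_int q" using norm_base norm_base_square by (auto simp: T_def)
  have A: "1 < A" using T w by (simp add: A_def)
  have X0: "0 < X" using X(2) A by (simp add: A_def T_def)
  have gen: ?thesis if "sqrt (1 + of_int q) < A - 1"
  proof -
    have "(A / 2) * ((A - 1) / A) \<le> X * ((A - 1) / A)"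
      using X(2) A by (intro mult_right_mono) (auto simp: A_def T_def)
    moreover have "(A / 2) * ((A - 1) / A) = (A - 1) / 2" "X * ((A - 1) / A) = X - X / A"
      using A by (simp_all add: field_simps)
    ultimately have "(A - 1) / 2 \<le> X - X / A" by (simp only:)
    then show ?thesis using that by (simp add: A_def T_def)
  qed
  have "T ^ 2 \<le> A" unfolding A_def using T w by (intro power_increasing) auto
  then have Aq: "of_int q \<le> A" using T by simp
  consider "4 \<le> q" | "q = 3" "w = 2" | "q = 2" "w = 2" | "q = 2 \<or> q = 3" "3 \<le> w"
    using q_ge_2 w by linarith
  then show ?thesis
  proof cases
    case 1
    then have "1 + real_of_int q < (of_int q - 1)\<^sup>2"
      using mult_right_mono[of 4 "real_of_int q" "real_of_int q"] by (simp add: power2_eq_square algebra_simps)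
    then have "sqrt (1 + of_int q) < of_int q - 1" using 1 by (intro real_less_lsqrt) auto
    then show ?thesis using Aq by (intro gen) simp
  next
    case 2
    have A3: "A = 3" using T 2 by (simp add: A_def)
    have "3/2 \<le> X" using X(2) A3 by (simp add: A_def T_def)
    \<comment> \<open>Only the boundary value gives equality, and its square 9/4 is not an
      integer.\<close>
    moreover have "X \<noteq> 3/2"
    proof
      assume "X = 3/2"
      have "real (4 * N) = real 9" using X(1) unfolding \<open>X = 3/2\<close> by (simp add: power_divide)
      then have "4 * N = 9" by (simp only: of_nat_eq_iff)
      then show False by presburger
    qed
    ultimately have "3/2 < X" by simp
    then show ?thesis using A3 2 by (simp add: A_def T_def)
  next
    case 3
    have A2: "A = 2" using T 3 by (simp add: A_def)
    have "4 \<le> N" using exc 3 by simp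
    then have "2\<^sup>2 \<le> X\<^sup>2" unfolding X by simp
    then have "2 \<le> X" by (rule power2_le_imp_le) (use X0 in simp)
    moreover have "sqrt 3 < 2" by (rule real_less_lsqrt) auto
    ultimately show ?thesis using A2 3 by (simp add: A_def T_def)
  next
    case 4
    have "T ^ 3 \<le> A" unfolding A_def using T 4 by (intro power_increasing) auto
    moreover have "T ^ 3 = of_int q * T" using T(2) by (simp add: power3_eq_cube power2_eq_square)
    moreover have "sqrt (1 + of_int q) < of_int q * T - 1" if "q = 2"
    proof -
      have "(1.4::real)\<^sup>2 \<le> T\<^sup>2" using T that by (simp add: power2_eq_square)
      then have "1.4 \<le> T" by (rule power2_le_imp_le) (use T in simp)
      moreover have "sqrt 3 < 1.75" by (rule real_less_lsqrt) (auto simp: power2_eq_square)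
      ultimately show ?thesis using that by simp
    qed
    moreover have "sqrt (1 + of_int q) < of_int q * T - 1" if "q = 3"
      using that T by simp
    ultimately show ?thesis using 4 by (intro gen) auto
  qed
qed

text \<open>Below half of \<open>cmod \<tau> ^ w\<close> an element not divisible by
  \<open>\<tau>\<close> is a digit; above it the quotient is shorter. The assumption
  \<open>small\<close> separates the descent from the finitely many elements where it
  stalls.\<close>

lemma all_representable:
  assumes small: "\<And>x. q = 2 \<Longrightarrow> w = 2 \<Longrightarrow> x \<in> zring \<tau> \<Longrightarrow> (cmod x)\<^sup>2 \<le> 3 \<Longrightarrow> representable x"
    and x: "x \<in> zring \<tau>"
  shows "representable x"
proof -
  obtain N :: nat where "(cmod x)\<^sup>2 = real N" using zring_norm_nat[OF x] .
  then show ?thesis using x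
  proof (induction N arbitrary: x rule: less_induct)
    case (less N)
    have IH: "representable y" if y: "y \<in> zring \<tau>" "cmod y < cmod x" for y
    proof -
      obtain K :: nat where K: "(cmod y)\<^sup>2 = real K" using zring_norm_nat[OF y(1)] .
      have "(cmod y)\<^sup>2 < (cmod x)\<^sup>2" using y(2) by (intro power_strict_mono) auto
      then have "K < N" using K less.prems(1) by simp
      then show ?thesis using less.IH K y(1) by blast
    qed
    consider "x = 0" | "x \<noteq> 0" "zring_dvd \<tau> \<tau> x" | "\<not> zring_dvd \<tau> \<tau> x" "cmod x < cmod \<tau> ^ w / 2"
      | "\<not> zring_dvd \<tau> \<tau> x" "cmod \<tau> ^ w / 2 \<le> cmod x" by linarith
    then show ?case
    proof cases
      case 1
      then show ?thesis using representable_0 by simp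
    next
      case 2
      then obtain y where y: "y \<in> zring \<tau>" "x = \<tau> * y" by (auto simp: zring_dvd_def)
      then have "1 * cmod y < cmod \<tau> * cmod y"
        using norm_base 2(1) by (intro mult_strict_right_mono) auto
      then show ?thesis using IH[OF y(1)] y(2) by (simp add: norm_mult representable_shift)
    next
      case 3
      have "0 < cmod \<tau> ^ w" using norm_base by (intro zero_less_power) linarith
      then have "cmod (x / \<tau> ^ w) < 1/2" using 3(2) by (simp add: norm_divide norm_power field_simps)
      then show ?thesis
        using 3 less.prems by (intro digit_representable digitI ball_subset_restricted_voronoi) auto
    next
      case 4
      show ?thesis
      proof (cases "q = 2 \<and> w = 2 \<and> N \<le> 3")
        case True
        then show ?thesis using small less.prems by simp
      next
        case False
        obtain d y where dy: "d \<in> digit_set \<tau> w" "y \<in> zring \<tau>" "x = d + \<tau> ^ w * y"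
            "cmod d \<le> cmod \<tau> ^ w * (sqrt (1 + of_int q) / 2)"
          using digit_decomposition[OF less.prems(2) 4(1)] .
        have A: "0 < cmod \<tau> ^ w" using norm_base by (intro zero_less_power) linarith
        have scale: "K * (a / K + r) = a + K * r" if "0 < K" for K a r :: real
          using that by (simp add: distrib_left)
        have "cmod \<tau> ^ w * cmod y = cmod (x - d)" by (simp add: dy(3) norm_mult norm_power)
        also have "\<dots> \<le> cmod x + cmod d" by (rule norm_triangle_ineq4)
        also have "\<dots> \<le> cmod x + cmod \<tau> ^ w * (sqrt (1 + of_int q) / 2)"
          using dy(4) by (rule add_left_mono)
        also have "\<dots> = cmod \<tau> ^ w * (cmod x / cmod \<tau> ^ w + sqrt (1 + of_int q) / 2)"
          using scale[OF A] by simp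
        finally have "cmod y \<le> cmod x / cmod \<tau> ^ w + sqrt (1 + of_int q) / 2"
          using A by (rule mult_left_le_imp_le)
        also have "\<dots> < cmod x" by (rule norm_decrease[OF less.prems(1) 4(2) False])
        finally show ?thesis using IH[OF dy(2)] representable_digit dy by blast
      qed
    qed
  qed
qed

section \<open>The short elements for q = w = 2\<close>

text \<open>Here \<open>\<tau>\<^sup>2 = -2\<close>, so 1 and \<open>1 - \<sigma>\<close> land on
  the left midpoint and the upper left corner of the cell. Both are kept, which makes them digits;
  their negatives need a second digit, for example -1 = 1 + \<open>\<tau>\<^sup>2\<close>.\<close>

lemma small_representable_0:
  assumes "p = 0" "q = 2" "w = 2" and x: "x \<in> zring \<tau>" "(cmod x)\<^sup>2 \<le> 3"
  shows "representable x"
proof -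
  define b where "b = \<bar>Im \<tau>\<bar>"
  have b: "0 < b" using Im_base_nonzero by (simp add: b_def)
  have t2: "\<tau>\<^sup>2 = -2" using base_square assms by simp
  \<comment> \<open>The cell does not depend on the choice of the root, so the digits are written
    with the root in the upper half-plane.\<close>
  define \<sigma> where "\<sigma> = Complex 0 b"
  have \<sigma>: "\<sigma> = \<tau> \<or> \<sigma> = - \<tau>"
    using Re_base assms by (auto simp: \<sigma>_def b_def complex_eq_iff)
  have \<sigma>L: "\<sigma> \<in> zring \<tau>" using \<sigma> zring_base zring_uminus by metis
  have V: "restricted_voronoi \<tau> = half_open_rectangle (b/2)"
    using restricted_voronoi_even assms by (simp add: b_def)
  have d1: "1 \<in> digit_set \<tau> w"
  proof (rule digitI)
    show "1 / \<tau> ^ w \<in> restricted_voronoi \<tau>"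
      unfolding V using b assms t2 by (intro half_open_rectangle_left) auto
    show "\<not> zring_dvd \<tau> \<tau> 1" by (rule unit_not_dvd) simp
  qed (use zring_of_int[of 1] in simp)
  have d2: "1 - \<sigma> \<in> digit_set \<tau> w"
  proof (rule digitI)
    show "(1 - \<sigma>) / \<tau> ^ w \<in> restricted_voronoi \<tau>"
      unfolding V using b assms t2 by (intro half_open_rectangle_top) (auto simp: \<sigma>_def)
    show "1 - \<sigma> \<in> zring \<tau>" using zring_diff \<sigma>L zring_of_int[of 1] by simp
    show "\<not> zring_dvd \<tau> \<tau> (1 - \<sigma>)"
    proof
      assume "zring_dvd \<tau> \<tau> (1 - \<sigma>)"
      then obtain e where e: "e \<in> zring \<tau>" "1 - \<sigma> = \<tau> * e" by (auto simp: zring_dvd_def)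
      have "1 = \<tau> * (e + 1) \<or> 1 = \<tau> * (e - 1)" using e(2) \<sigma> by (auto simp: algebra_simps)
      then have "zring_dvd \<tau> \<tau> 1"
        using e(1) zring_add zring_diff zring_of_int[of 1] unfolding zring_dvd_def by (metis of_int_1)
      then show False using unit_not_dvd[of 1] by simp
    qed
  qed
  note step1 = representable_digit[OF d1] and step2 = representable_digit[OF d2]
  have r1: "representable 1" by (rule digit_representable[OF d1])
  have r1': "representable (-1)" using step1[OF r1, of "-1"] assms t2 by simp
  have r2: "representable \<tau>" using representable_shift[OF r1] by simp
  have r2': "representable (- \<tau>)" using representable_shift[OF r1'] by simp
  have r3: "representable (1 - \<sigma>)" by (rule digit_representable[OF d2])
  have "representable (- \<sigma>)" using \<sigma> r2 r2' by auto
  then have r4: "representable (1 + \<sigma>)" using step2[of "- \<sigma>" "1 + \<sigma>"] assms t2 by simp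
  have r5: "representable (-1 + \<sigma>)" using step2[OF r3, of "-1 + \<sigma>"] assms t2 by (simp add: algebra_simps)
  have r6: "representable (-1 - \<sigma>)" using step2[OF r1, of "-1 - \<sigma>"] assms t2 by simp
  have comm: "- \<tau> - 1 = -1 - \<tau>" by simp
  have r7: "representable (1 + \<tau>)" "representable (1 - \<tau>)" "representable (-1 + \<tau>)" "representable (-1 - \<tau>)"
    using \<sigma> r3 r4 r5 r6 by (auto simp: comm)
  obtain m n where mn: "x = of_int m + of_int n * \<tau>" using x(1) by (rule zringE)
  have "real_of_int (m\<^sup>2 + 2 * n\<^sup>2) \<le> of_int 3"
    using x(2) assms unfolding mn zring_norm_form by simp
  then have le: "m\<^sup>2 + 2 * n\<^sup>2 \<le> 3" by (simp only: of_int_le_iff)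
  have "m\<^sup>2 < 4" "n\<^sup>2 < 4" using le zero_le_power2[of m] zero_le_power2[of n] by linarith+
  then have "\<bar>m\<bar> < 2" "\<bar>n\<bar> < 2" using abs_less_if_square_less[of _ 2] by simp_all
  then have "m \<in> {-1, 0, 1}" "n \<in> {-1, 0, 1}" by auto
  then show ?thesis unfolding mn using representable_0 r1 r1' r2 r2' r7 by (auto simp: comm)
qed

text \<open>Now 1 and -1 both land in the interior of the scaled hexagon. The other short elements
  are \<open>\<tau>\<close> and \<open>1 + \<tau>\<^sup>2 = of_int p * \<tau> - 1\<close>, up to
  sign.\<close>

lemma small_representable_1:
  assumes "p = 1 \<or> p = -1" "q = 2" "w = 2" and x: "x \<in> zring \<tau>" "(cmod x)\<^sup>2 \<le> 3"
  shows "representable x"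
proof -
  define b where "b = \<bar>Im \<tau>\<bar>"
  have b: "0 < b" using Im_base_nonzero by (simp add: b_def)
  have b2: "b\<^sup>2 = 7/4" using Im_base_square assms by (auto simp: b_def)
  have pp: "of_int p * of_int p = (1::real)" using assms by auto
  have t2: "\<tau>\<^sup>2 = of_int p * \<tau> - 2" using base_square assms by simp
  have R: "Re (\<tau>\<^sup>2) = - 3/2" and I: "Im (\<tau>\<^sup>2) = of_int p * Im \<tau>"
    unfolding t2 using pp by (simp_all add: Re_base)
  have n4: "(Re (\<tau>\<^sup>2))\<^sup>2 + (Im (\<tau>\<^sup>2))\<^sup>2 = 4"
    unfolding R I power_mult_distrib Im_base_square using assms by (auto simp: power2_eq_square)
  have inv: "Re (of_int k / \<tau>\<^sup>2) = of_int k * Re (\<tau>\<^sup>2) / 4" "Im (of_int k / \<tau>\<^sup>2) = - of_int k * Im (\<tau>\<^sup>2) / 4" for k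
    unfolding Re_divide Im_divide n4 by simp_all
  have V: "restricted_voronoi \<tau> = half_open_hexagon (b/2 + 1/(8*b)) (1/(2*b))"
    using restricted_voronoi_odd(1) assms by (auto simp: b_def)
  have digit: "of_int k \<in> digit_set \<tau> w" if k: "k = 1 \<or> k = -1" for k
  proof (rule digitI)
    have im: "\<bar>Re (of_int k / \<tau> ^ w)\<bar> = 3/8" "\<bar>Im (of_int k / \<tau> ^ w)\<bar> = b/4"
      unfolding assms(3) inv R I using k assms(1) by (auto simp: abs_mult b_def)
    have "b/4 + 1/(2*b) * (3/8) < b/2 + 1/(8*b)"
      using b b2 by (simp add: field_simps power2_eq_square)
    then show "of_int k / \<tau> ^ w \<in> restricted_voronoi \<tau>"
      unfolding V by (intro half_open_hexagonI(1); unfold im; simp)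
    show "\<not> zring_dvd \<tau> \<tau> (of_int k)" using k by (intro unit_not_dvd) auto
  qed (rule zring_of_int)
  have d: "1 \<in> digit_set \<tau> w" "-1 \<in> digit_set \<tau> w" using digit[of 1] digit[of "-1"] by auto
  have r: "representable 1" "representable (-1)" using d digit_representable by auto
  then have r\<tau>: "representable \<tau>" "representable (- \<tau>)"
    using representable_shift[of 1] representable_shift[of "-1"] by auto
  have rb: "representable (of_int p * \<tau> - 1)" "representable (1 - of_int p * \<tau>)"
    using representable_digit[OF d(1) r(1), of "of_int p * \<tau> - 1"]
      representable_digit[OF d(2) r(2), of "1 - of_int p * \<tau>"] t2 assms(3) by auto
  obtain m n where mn: "x = of_int m + of_int n * \<tau>" using x(1) by (rule zringE)
  have "real_of_int (m\<^sup>2 + p * m * n + 2 * n\<^sup>2) \<le> of_int 3"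
    using x(2) assms(2) unfolding mn zring_norm_form by simp
  then have le: "m\<^sup>2 + p * m * n + 2 * n\<^sup>2 \<le> 3" by (simp only: of_int_le_iff)
  have "p * p = 1" using assms by auto
  \<comment> \<open>Completing the square: four times the norm form is
    \<open>K + 7 * n\<^sup>2\<close>, which leaves few candidates for \<open>n\<close> and
    \<open>m\<close>.\<close>
  define K where "K = (2 * m + p * n)\<^sup>2"
  have "K = 4 * (m\<^sup>2 + p * m * n) + (p * p) * n\<^sup>2"
    by (simp add: K_def power2_eq_square algebra_simps)
  then have "K + 7 * n\<^sup>2 = 4 * (m\<^sup>2 + p * m * n + 2 * n\<^sup>2)" using \<open>p * p = 1\<close> by simp
  also have "\<dots> \<le> 4 * 3" using le by (rule mult_left_mono) simp
  finally have "K + 7 * n\<^sup>2 \<le> 12" by simp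
  moreover have "0 \<le> K" "0 \<le> n\<^sup>2" by (simp_all add: K_def)
  ultimately have "K < 16" "n\<^sup>2 < 4" by linarith+
  then have "\<bar>2 * m + p * n\<bar> < 4" "\<bar>n\<bar> < 2"
    using abs_less_if_square_less[of _ 4] abs_less_if_square_less[of _ 2] by (simp_all add: K_def)
  then have "n \<in> {-1, 0, 1}" "m \<in> {-2, -1, 0, 1, 2}" using assms(1) by auto
  then have "x \<in> {0, 1, -1, \<tau>, - \<tau>, of_int p * \<tau> - 1, 1 - of_int p * \<tau>}"
    using le assms(1) unfolding mn by auto
  then show ?thesis using representable_0 r r\<tau> rb by auto
qed

text \<open>The lattice is that of the Gaussian integers. Two of the four units land on kept
  midpoints and are digits; the other two arise from \<open>\<tau>\<^sup>2\<close> times a unit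
  already expanded. The elements of norm 2 are \<open>\<tau>\<close> times a unit.\<close>

lemma small_representable_2:
  assumes "p = 2 \<or> p = -2" "q = 2" "w = 2" and x: "x \<in> zring \<tau>" "(cmod x)\<^sup>2 \<le> 3"
  shows "representable x"
proof -
  have "(Im \<tau>)\<^sup>2 = 1" using Im_base_square assms by auto
  then have Im1: "Im \<tau> = 1 \<or> Im \<tau> = -1" by (simp add: power2_eq_1_iff)
  have Re1: "Re \<tau> = 1 \<or> Re \<tau> = -1" using Re_base assms by auto
  have L: "zring \<tau> = rect_lattice 1" using zring_even assms Im1 by auto
  have V: "restricted_voronoi \<tau> = half_open_rectangle (1/2)" using restricted_voronoi_even assms Im1 by auto
  \<comment> \<open>The sign \<open>t\<close> unifies the four possible bases, since
    \<open>\<tau>\<^sup>2\<close> is 2 or -2 times the imaginary unit.\<close>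
  define t where "t = Re \<tau> * Im \<tau>"
  have t: "t = 1 \<or> t = -1" using Re1 Im1 by (auto simp: t_def)
  have t2: "\<tau> ^ w = Complex 0 (2 * t)"
    using Re1 Im1 assms(3) by (auto simp: complex_eq_iff power2_eq_square t_def)
  have gauss: "Complex (of_int m) (of_int n) \<in> zring \<tau>" for m n
    unfolding L rect_lattice_def by force
  have digit: "Complex (-t) 0 \<in> digit_set \<tau> w" "Complex 0 (-t) \<in> digit_set \<tau> w"
  proof -
    have "Complex (-t) 0 / \<tau> ^ w = Complex 0 (1/2)" "Complex 0 (-t) / \<tau> ^ w = Complex (-1/2) 0"
      unfolding t2 using t by (auto simp: complex_eq_iff Re_divide Im_divide)
    then have "Complex (-t) 0 / \<tau> ^ w \<in> restricted_voronoi \<tau>" "Complex 0 (-t) / \<tau> ^ w \<in> restricted_voronoi \<tau>"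
      unfolding V by (simp_all add: half_open_rectangle_def)
    moreover have "Complex (-t) 0 \<in> zring \<tau>" "Complex 0 (-t) \<in> zring \<tau>"
      using t gauss[of 1 0] gauss[of "-1" 0] gauss[of 0 1] gauss[of 0 "-1"] by auto
    moreover have "cmod (Complex (-t) 0) = 1" "cmod (Complex 0 (-t)) = 1"
      using t by (auto simp: cmod_def)
    ultimately show "Complex (-t) 0 \<in> digit_set \<tau> w" "Complex 0 (-t) \<in> digit_set \<tau> w"
      using unit_not_dvd digitI by blast+
  qed
  note step1 = representable_digit[OF digit(1)] and step2 = representable_digit[OF digit(2)]
  have u: "representable (Complex 1 0) \<and> representable (Complex (-1) 0) \<and>
      representable (Complex 0 1) \<and> representable (Complex 0 (-1))"
    using t
  proof
    assume "t = 1"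
    then have r: "representable (Complex (-1) 0)" "representable (Complex 0 (-1))"
      using digit digit_representable by auto
    have "representable (Complex 1 0)" using step1[OF r(2), of "Complex 1 0"] t2 \<open>t = 1\<close> by (simp add: complex_eq_iff)
    moreover from this have "representable (Complex 0 1)"
      using step2[of "Complex 1 0" "Complex 0 1"] t2 \<open>t = 1\<close> by (simp add: complex_eq_iff)
    ultimately show ?thesis using r by blast
  next
    assume "t = -1"
    then have r: "representable (Complex 1 0)" "representable (Complex 0 1)"
      using digit digit_representable by auto
    have "representable (Complex 0 (-1))" using step2[OF r(1), of "Complex 0 (-1)"] t2 \<open>t = -1\<close> by (simp add: complex_eq_iff)
    moreover from this have "representable (Complex (-1) 0)"
      using step1[of "Complex 0 (-1)" "Complex (-1) 0"] t2 \<open>t = -1\<close> by (simp add: complex_eq_iff)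
    ultimately show ?thesis using r by blast
  qed
  define X Y where "X = Re \<tau>" and "Y = Im \<tau>"
  have XY: "\<tau> = Complex X Y" "X = 1 \<or> X = -1" "Y = 1 \<or> Y = -1" using Re1 Im1 by (auto simp: X_def Y_def)
  have "\<tau> * Complex 1 0 = Complex X Y" "\<tau> * Complex (-1) 0 = Complex (-X) (-Y)"
    "\<tau> * Complex 0 1 = Complex (-Y) X" "\<tau> * Complex 0 (-1) = Complex Y (-X)"
    unfolding XY(1) by (simp_all add: complex_eq_iff)
  then have v: "representable (Complex X Y)" "representable (Complex (-X) (-Y))"
    "representable (Complex (-Y) X)" "representable (Complex Y (-X))"
    using u representable_shift by metis+
  then have v': "representable (Complex 1 1)" "representable (Complex (-1) 1)"
    "representable (Complex 1 (-1))" "representable (Complex (-1) (-1))"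
    using XY(2,3) by auto
  obtain m n where mn: "x = Complex (of_int m) (of_int n)"
    using x(1) unfolding L rect_lattice_def by auto
  have "real_of_int (m\<^sup>2 + n\<^sup>2) \<le> of_int 3"
    using x(2) unfolding mn cmod_power2 by simp
  then have le: "m\<^sup>2 + n\<^sup>2 \<le> 3" by (simp only: of_int_le_iff)
  have "m\<^sup>2 < 4" "n\<^sup>2 < 4" using le zero_le_power2[of m] zero_le_power2[of n] by linarith+
  then have "\<bar>m\<bar> < 2" "\<bar>n\<bar> < 2" using abs_less_if_square_less[of _ 2] by simp_all
  then have "m \<in> {-1, 0, 1}" "n \<in> {-1, 0, 1}" by auto
  then show ?thesis unfolding mn using representable_0[unfolded zero_complex.code] u v' by auto
qed

lemma zring_representable:
  assumes "x \<in> zring \<tau>"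
  shows "representable x"
proof (rule all_representable[OF _ assms])
  fix x assume *: "q = 2" "w = 2" "x \<in> zring \<tau>" "(cmod x)\<^sup>2 \<le> 3"
  have "p\<^sup>2 < 3\<^sup>2" using disc *(1) by simp
  then have "\<bar>p\<bar> < 3" by (rule abs_less_if_square_less) simp
  then consider "p = 0" | "p = 1 \<or> p = -1" | "p = 2 \<or> p = -2" by linarith
  then show "representable x"
    using small_representable_0 small_representable_1 small_representable_2 * by cases blast+
qed

sublocale naf_system \<tau> w "zring \<tau>" "digit_set \<tau> w" "sqrt (1 + of_int q) / 2"
proof
  show "0 \<in> digit_set \<tau> w" by (simp add: digit_set_def)
  show "\<exists>x\<in>zring \<tau>. cmod (z - x) \<le> sqrt (1 + of_int q) / 2" for z
    using restricted_voronoi_tiles[of z] restricted_voronoi_norm by blast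
  show "(\<exists>y\<in>zring \<tau>. x = \<tau> * y) \<or> (\<exists>d\<in>digit_set \<tau> w. \<exists>y\<in>zring \<tau>. x = d + \<tau> ^ w * y \<and>
      cmod d \<le> cmod \<tau> ^ w * (sqrt (1 + of_int q) / 2))" if "x \<in> zring \<tau>" for x
    using digit_decomposition[OF that] unfolding zring_dvd_def by metis
qed (use norm_base w finite_digit_set finite_zring_ball zring_representable in auto)

end

theorem theorem7p5:
  fixes p q :: int and \<tau> :: complex and w :: nat
  assumes "4 * q - p ^ 2 > 0"
    and "\<tau> ^ 2 - of_int p * \<tau> + of_int q = 0"
    and "cmod \<tau> > 1"
    and "w \<ge> 2"
  shows "\<forall>z :: complex. \<exists>\<eta> :: int \<Rightarrow> complex.
           w_NAF \<tau> w \<eta> \<and> left_length \<eta> < \<infinity> \<and>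
           ((\<lambda>j. \<eta> j * \<tau> powi j) has_sum z) UNIV"
proof
  fix z :: complex
  interpret wnaf_base p q \<tau> w by standard (use assms in auto)
  obtain \<eta> :: "int \<Rightarrow> complex" and M where \<eta>: "range \<eta> \<subseteq> digit_set \<tau> w" "separated w \<eta>"
      "\<forall>j\<ge>M. \<eta> j = 0" "((\<lambda>j. \<eta> j * \<tau> powi j) has_sum z) UNIV"
    using expansion_exists[of z] by blast
  have "w_NAF \<tau> w \<eta>" unfolding w_NAF_def using \<eta>(1,2) card_window_le_1 by blast
  moreover have "left_length \<eta> < \<infinity>" using \<eta>(3) left_length_finite by blast
  ultimately show "\<exists>\<eta> :: int \<Rightarrow> complex. w_NAF \<tau> w \<eta> \<and> left_length \<eta> < \<infinity> \<and>
      ((\<lambda>j. \<eta> j * \<tau> powi j) has_sum z) UNIV"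
    using \<eta>(4) by blast
qed

end
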